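(* Let $C=\langle a,b\rangle$ be an HFP-code of type Q of length $4n$ whose kernel has dimension $2$. Let $H$ be the $4n\times 4n$ binary matrix whose rows are the codewords of $C$ having a $0$ in the first coordinate (in any order), and let $C^T$ (the transpose code of $C$) be the code consisting of the columns of $H$ together with their complements. Then the kernel of $C^T$ has dimension $1$.
   Context: Let $\mathbb{F}=\mathbb{Z}_2$. $\mathbf 0,\mathbf 1$ denote the all-zero and all-one vectors; for a permutation $\pi$ of $\{1,\dots,m\}$ and $v\in\mathbb{F}^m$, $\pi(v)=(v_{\pi^{-1}(1)},\dots,v_{\pi^{-1}(m)})$. A binary Hadamard matrix of order $4n$ is obtained from a $4n\times4n$ matrix with entries $\pm1$ and $HH^T=4nI$ by replacing $+1$ by $0$ and $-1$ by $1$; the binary Hadamard code it defines is the set of its rows together with their complements. A code $C\subseteq\mathbb{F}^m$ with $\mathbf 0\in C$ is propelinear if to each $x\in C$ a coordinate permutation $\pi_x$ is assigned such that for all $x,y\in C$: $x+\pi_x(y)\in C$ and $\pi_x\pi_y=\pi_{x+\pi_x(y)}$; then $x\cdot y:=x+\pi_x(y)$ makes $(C,\cdot)$ a group with identity $\mathbf 0$. An HFP-code of length $4n$ is a propelinear code that is also a binary Hadamard code of length $4n$, with $\pi_{\mathbf 0}=\pi_{\mathbf 1}=\mathrm{id}$ and such that for every $a\in C\setminus\{\mathbf 0,\mathbf 1\}$, $\pi_a$ has no fixed coordinate. An HFP-code $C$ of length $4n$ is of type Q, written $C=\langle a,b\rangle$, if there are $a,b\in C$ generating $(C,\cdot)$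 with $(C,\cdot)$ having presentation $\langle a,b: a^{4n}=\mathbf 0,\ a^{2n}=b^2,\ b^{-1}ab=a^{-1}\rangle$. The kernel of a code $C\subseteq\mathbb{F}^m$ is $K(C)=\{z\in\mathbb{F}^m: C+z=C\}$, a linear subspace. *)

theory Defs
  imports
    "HOL-Analysis.Analysis"
    "HOL-Library.Z2"
    "HOL-Algebra.Generated_Groups"
begin

text \<open>
  Binary words of length \<open>m\<close> are elements of \<open>bit ^ 'm\<close> with \<open>CARD('m) = m\<close>;
  \<open>0\<close> and \<open>1\<close> are the all-zero and all-one words, so \<open>x + 1\<close> is the complement of \<open>x\<close>.
\<close>

definition perm_action :: "('m \<Rightarrow> 'm) \<Rightarrow> bit ^ 'm \<Rightarrow> bit ^ 'm" where
  "perm_action p v = (\<chi> i. v $ (inv_into UNIV p i))"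

definition with_complements :: "(bit ^ 'm) set \<Rightarrow> (bit ^ 'm) set" where
  "with_complements S = S \<union> (\<lambda>x. x + 1) ` S"

definition hadamard_matrix :: "int ^ 'm ^ 'm \<Rightarrow> bool" where
  "hadamard_matrix M \<longleftrightarrow>
     (\<forall>i j. M $ i $ j = 1 \<or> M $ i $ j = - 1) \<and>
     M ** transpose M = mat (int CARD('m))"

definition binary_matrix_of :: "int ^ 'm ^ 'm \<Rightarrow> bit ^ 'm ^ 'm" where
  "binary_matrix_of M = (\<chi> i j. if M $ i $ j = 1 then 0 else 1)"

definition binary_hadamard_code :: "(bit ^ 'm) set \<Rightarrow> bool" where
  "binary_hadamard_code C \<longleftrightarrow>
     (\<exists>M. hadamard_matrix M \<and> C = with_complements (rows (binary_matrix_of M)))"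

definition propelinear_code :: "(bit ^ 'm) set \<Rightarrow> (bit ^ 'm \<Rightarrow> 'm \<Rightarrow> 'm) \<Rightarrow> bool" where
  "propelinear_code C \<pi> \<longleftrightarrow>
     0 \<in> C \<and>
     (\<forall>x\<in>C. bij (\<pi> x)) \<and>
     (\<forall>x\<in>C. \<forall>y\<in>C. x + perm_action (\<pi> x) y \<in> C \<and>
        \<pi> x \<circ> \<pi> y = \<pi> (x + perm_action (\<pi> x) y))"

definition propelinear_group ::
    "(bit ^ 'm) set \<Rightarrow> (bit ^ 'm \<Rightarrow> 'm \<Rightarrow> 'm) \<Rightarrow> (bit ^ 'm) monoid" where
  "propelinear_group C \<pi> =
     \<lparr>carrier = C, mult = (\<lambda>x y. x + perm_action (\<pi> x) y), one = 0\<rparr>"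

definition hfp_code :: "(bit ^ 'm) set \<Rightarrow> (bit ^ 'm \<Rightarrow> 'm \<Rightarrow> 'm) \<Rightarrow> bool" where
  "hfp_code C \<pi> \<longleftrightarrow>
     propelinear_code C \<pi> \<and> binary_hadamard_code C \<and>
     \<pi> 0 = id \<and> \<pi> 1 = id \<and>
     (\<forall>x\<in>C - {0, 1}. \<forall>i. \<pi> x i \<noteq> i)"

text \<open>
  Group presentations. A word in the generators \<open>'g\<close> and their formal inverses is a list of
  pairs \<open>(g, e)\<close>, where \<open>e\<close> is \<open>True\<close> for \<open>g\<close> and \<open>False\<close> for its inverse. The congruence
  \<open>pres_cong R\<close> identifies two words iff they represent the same element of the free group
  modulo the normal closure of the relations \<open>l = r\<close> with \<open>(l, r) \<in> R\<close>.
\<close>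

type_synonym 'g gword = "('g \<times> bool) list"

inductive pres_cong :: "('g gword \<times> 'g gword) set \<Rightarrow> 'g gword \<Rightarrow> 'g gword \<Rightarrow> bool"
  for R :: "('g gword \<times> 'g gword) set" where
  pc_refl: "pres_cong R u u"
| pc_sym: "pres_cong R u v \<Longrightarrow> pres_cong R v u"
| pc_trans: "pres_cong R u v \<Longrightarrow> pres_cong R v w \<Longrightarrow> pres_cong R u w"
| pc_cancel: "pres_cong R (u @ [(g, e), (g, \<not> e)] @ v) (u @ v)"
| pc_relation: "(l, r) \<in> R \<Longrightarrow> pres_cong R (u @ l @ v) (u @ r @ v)"

definition gword_eval :: "('a, 'x) monoid_scheme \<Rightarrow> ('g \<Rightarrow> 'a) \<Rightarrow> 'g gword \<Rightarrow> 'a" where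
  "gword_eval G f w =
     foldr (\<lambda>(g, e) x. (if e then f g else inv\<^bsub>G\<^esub> (f g)) \<otimes>\<^bsub>G\<^esub> x) w \<one>\<^bsub>G\<^esub>"

definition has_presentation ::
    "('a, 'x) monoid_scheme \<Rightarrow> ('g \<Rightarrow> 'a) \<Rightarrow> ('g gword \<times> 'g gword) set \<Rightarrow> bool" where
  "has_presentation G f R \<longleftrightarrow>
     range f \<subseteq> carrier G \<and>
     generate G (range f) = carrier G \<and>
     (\<forall>u v. gword_eval G f u = gword_eval G f v \<longleftrightarrow> pres_cong R u v)"

datatype gen = Gen_a | Gen_b

definition type_Q_relations :: "nat \<Rightarrow> (gen gword \<times> gen gword) set" where
  "type_Q_relations n =
     {(replicate (4 * n) (Gen_a, True), []),
      (replicate (2 * n) (Gen_a, True), [(Gen_b, True), (Gen_b, True)]),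
      ([(Gen_b, False), (Gen_a, True), (Gen_b, True)], [(Gen_a, False)])}"

definition hfp_code_type_Q ::
    "nat \<Rightarrow> (bit ^ 'm) set \<Rightarrow> (bit ^ 'm \<Rightarrow> 'm \<Rightarrow> 'm) \<Rightarrow> bit ^ 'm \<Rightarrow> bit ^ 'm \<Rightarrow> bool" where
  "hfp_code_type_Q n C \<pi> a b \<longleftrightarrow>
     CARD('m) = 4 * n \<and> hfp_code C \<pi> \<and>
     has_presentation (propelinear_group C \<pi>) (case_gen a b) (type_Q_relations n)"

definition code_kernel :: "(bit ^ 'm) set \<Rightarrow> (bit ^ 'm) set" where
  "code_kernel C = {z. (\<lambda>x. x + z) ` C = C}"

lemma subspace_code_kernel: "vec.subspace (code_kernel C)"
proof (rule vec.subspaceI)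
  show z: "0 \<in> code_kernel C"
    by (simp add: code_kernel_def)
  show "x + y \<in> code_kernel C" if "x \<in> code_kernel C" "y \<in> code_kernel C" for x y
  proof -
    have "(\<lambda>c. c + (x + y)) ` C = (\<lambda>c. c + y) ` (\<lambda>c. c + x) ` C"
      by (simp add: image_image add.assoc)
    with that show ?thesis
      by (simp add: code_kernel_def)
  qed
  show "c *s x \<in> code_kernel C" if "x \<in> code_kernel C" for c x
    using that z by (cases c) auto
qed

text \<open>The coordinates are linearly ordered, so the first one is \<open>Min UNIV\<close>.\<close>

definition row_matrix_of_code ::
    "(bit ^ 'm::{finite,linorder}) set \<Rightarrow> bit ^ ('m::{finite,linorder}) ^ ('m::{finite,linorder}) \<Rightarrow> bool" where
  "row_matrix_of_code C H \<longleftrightarrow>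
     bij_betw (\<lambda>i. row i H) UNIV {x \<in> C. x $ Min UNIV = 0}"

definition column_code :: "bit ^ 'm ^ 'm \<Rightarrow> (bit ^ 'm) set" where
  "column_code H = with_complements (columns H)"

end

theory Submission
  imports Defs "HOL-Number_Theory.Cong" "HOL-Algebra.Multiplicative_Group"
begin

text \<open>
  Let \<open>f x\<close> be the first coordinate of \<open>x \<in> C\<close>. Up to adding \<open>f\<close>, the codewords of \<open>C\<close> are the
  right translates of \<open>f\<close> on the dicyclic group \<open>(C, \<cdot>)\<close>, and those of the transpose code are its left
  translates. If the kernel of \<open>C\<close> is \<open>{0, 1, h, h + 1}\<close>, then its invariance under the coordinate
  permutations yields a homomorphism \<open>\<psi>\<close> into \<open>\<int>\<^sub>2\<close> with \<open>f (x \<cdot> h) = f x + \<psi> x\<close> after normalizing \<open>h\<close>.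
  Such an \<open>h\<close> has order 4. The autocorrelation at \<open>m\<close> of a binary sequence with
  \<open>s (k + N) = s k + 1\<close> is congruent to \<open>N - 2 m\<close> modulo 4, and comparing this with the orthogonality of
  the rows shows that \<open>h\<close> is not a power of \<open>a\<close>, that \<open>n\<close> is even and that \<open>\<psi> a = 1\<close>. Now
  \<open>h\<close> may replace \<open>b\<close>, so \<open>f\<close> is determined by the sequence \<open>s k = f (a\<^sup>k)\<close>, which is orthogonal to
  its shifts by even amounts. Moreover \<open>n > 2\<close>, since Hadamard codes of length 4 and 8 are linear.

  If \<open>f\<close> plus an element of the left kernel is the translate of \<open>f\<close> by \<open>g\<close>, call \<open>g\<close> a shift. The
  shifts form a group without nontrivial elements of odd order, so if it contains a noncentral power of \<open>a\<close>,
  it contains \<open>a\<^sup>n\<close>, and summing \<open>n\<close> translates of the corresponding kernel element gives one that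
  changes by 1 at each step along the powers of \<open>a\<close>. If it does not, any further kernel element
  is affine along these powers. Either way \<open>s (w + k)\<close> or \<open>s (w - k)\<close> is \<open>s k\<close> plus an affine function
  of \<open>k\<close>. Orthogonality and the mod 4 congruence for \<open>k \<mapsto> s (2 k)\<close> rule this out.
\<close>

declare add_bit_eq_xor [simp del] mult_bit_eq_and [simp del]

section \<open>Binary sequences and their autocorrelation\<close>

lemma bit_add_self [simp]: "x + x = (0::bit)"
  by (cases x) auto

lemma bit_add_self_left [simp]: "x + (x + y) = (y::bit)"
  by (simp flip: add.assoc)

lemma bit_add_eq_iff: "x + y = z \<longleftrightarrow> x = z + (y::bit)"
  by (cases x; cases y; cases z) auto

lemma of_int_bit: "(of_int k :: bit) = (if even k then 0 else 1)"
  by (cases "even k") (auto elim!: evenE oddE)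

lemma of_nat_bit: "(of_nat k :: bit) = (if even k then 0 else 1)"
  using of_int_bit[of "int k"] by simp

lemma int_affine:
  fixes u :: "int \<Rightarrow> 'a::ring_1"
  assumes "\<And>k. u (k + 1) = u k + c"
  shows "u k = u 0 + of_int k * c"
proof (induction k rule: int_induct[where k = 0])
  case (step1 i)
  then show ?case using assms[of i] by (simp add: algebra_simps)
next
  case (step2 i)
  then show ?case using assms[of "i - 1"] by (simp add: algebra_simps)
qed simp

lemma quasiperiodic_mult:
  fixes u :: "int \<Rightarrow> 'a::ring_1"
  assumes "\<And>k. u (k + p) = u k + c"
  shows "u (k + p * q) = u k + of_int q * c"
proof -
  have "u (k + p * (q + 1)) = u (k + p * q) + c" for q
    using assms[of "k + p * q"] by (simp add: algebra_simps)
  from int_affine[of "\<lambda>q. u (k + p * q)", OF this] show ?thesis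
    by simp
qed

lemma sum_quasiperiodic_shift:
  fixes u :: "int \<Rightarrow> 'a::ring_1"
  assumes "\<And>k. u (k + int N) = u k + c"
  shows "(\<Sum>i<N. u (int i + m)) = (\<Sum>i<N. u (int i)) + of_int m * c"
proof -
  have "(\<Sum>i<N. u (int i + (m + 1))) = (\<Sum>i<N. u (int i + m)) + c" for m
  proof -
    have "(\<Sum>i<N. u (int i + (m + 1))) - (\<Sum>i<N. u (int i + m)) = u (int N + m) - u (int 0 + m)"
      using sum_lessThan_telescope[of "\<lambda>i. u (int i + m)" N]
      by (simp add: sum_subtractf add.assoc add.commute add.left_commute)
    also have "\<dots> = c"
      using assms[of m] by (simp add: add.commute)
    finally show ?thesis by (simp add: diff_eq_eq add.commute)
  qed
  from int_affine[of "\<lambda>m. \<Sum>i<N. u (int i + m)", OF this] show ?thesis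
    by simp
qed

lemma sum_periodic_shift:
  fixes u :: "int \<Rightarrow> 'a::ring_1"
  assumes "\<And>k. u (k + int N) = u k"
  shows "(\<Sum>i<N. u (int i + m)) = (\<Sum>i<N. u (int i))"
  using sum_quasiperiodic_shift[of u N 0] assms by simp

lemma sum_periodic_reflect:
  fixes u :: "int \<Rightarrow> 'a::ring_1"
  assumes periodic: "\<And>k. u (k + int N) = u k"
  shows "(\<Sum>i<N. u (m - int i)) = (\<Sum>i<N. u (int i))"
proof -
  have "(\<Sum>i<N. u (m - int i)) = (\<Sum>i<N. u (m - int (N - Suc i)))"
    by (rule sum.nat_diff_reindex[symmetric])
  also have "\<dots> = (\<Sum>i<N. u (int i + (m + 1)))"
  proof (rule sum.cong)
    fix i assume "i \<in> {..<N}"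
    then have "m - int (N - Suc i) + int N = int i + (m + 1)"
      by (auto simp: of_nat_diff)
    then show "u (m - int (N - Suc i)) = u (int i + (m + 1))"
      using periodic[of "m - int (N - Suc i)"] by metis
  qed simp
  also have "\<dots> = (\<Sum>i<N. u (int i))"
    using periodic by (rule sum_periodic_shift)
  finally show ?thesis .
qed

lemma sum_lessThan_double:
  fixes u :: "int \<Rightarrow> 'a::comm_monoid_add"
  assumes "\<And>k. u (k + int N) = u k"
  shows "(\<Sum>i<2 * N. u (int i)) = (\<Sum>i<N. u (int i)) + (\<Sum>i<N. u (int i))"
proof -
  have "(\<Sum>i<N + M. u (int i)) = (\<Sum>i<N. u (int i)) + (\<Sum>i<M. u (int i + int N))" for M
    by (induction M) (simp_all add: ac_simps)
  from this[of N] show ?thesis by (simp add: assms mult_2)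
qed

definition bit_sign :: "bit \<Rightarrow> int" where
  "bit_sign x = (if x = 0 then 1 else - 1)"

lemma bit_sign_simps [simp]: "bit_sign 0 = 1" "bit_sign 1 = - 1"
  by (simp_all add: bit_sign_def)

lemma bit_sign_add: "bit_sign (x + y) = bit_sign x * bit_sign y"
  by (cases x; cases y) auto

lemma bit_sign_neq_0 [simp]: "bit_sign x \<noteq> 0"
  by (simp add: bit_sign_def)

lemma sum_bit_sign_cong:
  assumes "finite S" "(\<Sum>i\<in>S. h i) = of_int c"
  shows "[(\<Sum>i\<in>S. bit_sign (h i)) = int (card S) - 2 * c] (mod 4)"
  using assms
proof (induction S arbitrary: c rule: finite_induct)
  case empty
  then show ?case by (auto simp: of_int_bit cong_iff_dvd_diff split: if_splits)
next
  case (insert x S)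
  show ?case
  proof (cases "h x = 0")
    case True
    with insert have "[(\<Sum>i\<in>S. bit_sign (h i)) = int (card S) - 2 * c] (mod 4)" by simp
    then show ?thesis
      using insert True by (simp add: cong_iff_dvd_diff algebra_simps)
  next
    case False
    with insert have "1 + (\<Sum>i\<in>S. h i) = of_int c" by simp
    then have "(\<Sum>i\<in>S. h i) = of_int (c - 1)"
      using bit_add_self_left[of 1 "\<Sum>i\<in>S. h i"] by (simp add: add.commute)
    then have "[(\<Sum>i\<in>S. bit_sign (h i)) = int (card S) - 2 * (c - 1)] (mod 4)"
      by (rule insert.IH)
    then show ?thesis
      using insert False by (simp add: cong_iff_dvd_diff algebra_simps)
  qed
qed

definition negaperiodic :: "nat \<Rightarrow> (int \<Rightarrow> bit) \<Rightarrow> bool" where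
  "negaperiodic N s \<longleftrightarrow> (\<forall>k. s (k + int N) = s k + 1)"

definition autocorrelation :: "nat \<Rightarrow> (int \<Rightarrow> bit) \<Rightarrow> int \<Rightarrow> int" where
  "autocorrelation N s m = (\<Sum>i<N. bit_sign (s (int i) + s (int i + m)))"

lemma negaperiodic_mult: "negaperiodic N s \<Longrightarrow> s (k + int N * q) = s k + of_int q"
  using quasiperiodic_mult[of s "int N" 1 k q] by (simp add: negaperiodic_def)

lemma negaperiodic_decimation: "negaperiodic (2 * N) s \<Longrightarrow> negaperiodic N (\<lambda>k. s (2 * k))"
  unfolding negaperiodic_def
proof
  fix k assume "\<forall>k. s (k + int (2 * N)) = s k + 1"
  from spec[OF this, of "2 * k"] show "s (2 * (k + int N)) = s (2 * k) + 1"
    by (simp add: algebra_simps)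
qed

lemma autocorrelation_term_periodic:
  assumes "negaperiodic N s"
  shows "bit_sign (s (k + int N) + s (k + int N + m)) = bit_sign (s k + s (k + m))"
proof -
  have "s (k + int N) + s (k + int N + m) = s k + s (k + m)"
    using assms[unfolded negaperiodic_def, rule_format, of k]
      assms[unfolded negaperiodic_def, rule_format, of "k + m"]
    by (simp add: ac_simps)
  then show ?thesis by simp
qed

lemma autocorrelation_cong_mod_4:
  assumes "negaperiodic N s"
  shows "[autocorrelation N s m = int N - 2 * m] (mod 4)"
proof -
  have "(\<Sum>i<N. s (int i) + s (int i + m)) = of_int m"
    using sum_quasiperiodic_shift[of s N 1 m] assms by (simp add: negaperiodic_def sum.distrib)
  from sum_bit_sign_cong[OF finite_lessThan this] show ?thesis
    by (simp add: autocorrelation_def)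
qed

lemma autocorrelation_quasiperiod:
  "(\<And>k. s (k + m) = s k + c) \<Longrightarrow> autocorrelation N s m = int N * bit_sign c"
  by (simp add: autocorrelation_def)

lemma autocorrelation_add_affine:
  assumes "d * of_int m = 0"
  shows "autocorrelation N (\<lambda>k. s k + (c + d * of_int k)) m = autocorrelation N s m"
proof -
  have "s k + (c + d * of_int k) + (s (k + m) + (c + d * of_int (k + m))) = s k + s (k + m)" for k
    using assms by (simp add: algebra_simps)
  then show ?thesis by (simp only: autocorrelation_def)
qed

lemma autocorrelation_shift:
  assumes "negaperiodic N s"
  shows "autocorrelation N (\<lambda>k. s (k + p)) m = autocorrelation N s m"
  using sum_periodic_shift[of "\<lambda>k. bit_sign (s k + s (k + m))" N p]
    autocorrelation_term_periodic[OF assms]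
  by (simp add: autocorrelation_def ac_simps)

lemma autocorrelation_minus:
  assumes "negaperiodic N s"
  shows "autocorrelation N s (- m) = autocorrelation N s m"
  using sum_periodic_shift[of "\<lambda>k. bit_sign (s k + s (k + m))" N "- m"]
    autocorrelation_term_periodic[OF assms]
  by (simp add: autocorrelation_def add.commute)

lemma autocorrelation_double:
  assumes "negaperiodic N s"
  shows "autocorrelation (2 * N) s m = 2 * autocorrelation N s m"
  using sum_lessThan_double[of "\<lambda>k. bit_sign (s k + s (k + m))" N]
    autocorrelation_term_periodic[OF assms]
  by (simp add: autocorrelation_def)

lemma autocorrelation_reflect:
  assumes "negaperiodic N s"
  shows "autocorrelation N (\<lambda>k. s (p - k)) m = autocorrelation N s m"
proof -
  have "s (p - k) + s (p - (k + m)) = s (p - m - k) + s (p - m - k + m)" for k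
    by (simp add: algebra_simps)
  then have "autocorrelation N (\<lambda>k. s (p - k)) m
      = (\<Sum>i<N. bit_sign (s (p - m - int i) + s (p - m - int i + m)))"
    by (simp only: autocorrelation_def)
  also have "\<dots> = autocorrelation N s m"
    unfolding autocorrelation_def
    by (rule sum_periodic_reflect[of "\<lambda>k. bit_sign (s k + s (k + m))"])
      (rule autocorrelation_term_periodic[OF assms])
  finally show ?thesis .
qed

lemma autocorrelation_decimation:
  "autocorrelation (2 * N) s (2 * m) =
     autocorrelation N (\<lambda>k. s (2 * k)) m + autocorrelation N (\<lambda>k. s (2 * k + 1)) m"
proof -
  have "(\<Sum>i<2 * N. h i) = (\<Sum>i<N. h (2 * i)) + (\<Sum>i<N. h (2 * i + 1))" for h :: "nat \<Rightarrow> int"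
    by (induction N) (simp_all add: ac_simps)
  then show ?thesis
    by (simp add: autocorrelation_def algebra_simps)
qed

lemma autocorrelation_odd_shift:
  assumes periodic: "negaperiodic (2 * N) s" and "odd w"
    and shift: "\<And>k. s (k + w) = s k + of_int k + c"
  shows "autocorrelation (2 * N) s (2 * m) = 2 * autocorrelation N (\<lambda>k. s (2 * k)) m"
proof -
  from \<open>odd w\<close> obtain l where l: "w = 2 * l + 1" by (elim oddE)
  have "s (2 * k + 1) = s (2 * (k + (l + 1))) + (c + 1)" for k
    using shift[of "2 * k + 1"] by (simp add: l algebra_simps)
  then have "autocorrelation N (\<lambda>k. s (2 * k + 1)) m
      = autocorrelation N (\<lambda>k. s (2 * (k + (l + 1)))) m"
    using autocorrelation_add_affine[of 0 m N "\<lambda>k. s (2 * (k + (l + 1)))" "c + 1"] by simp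
  also have "\<dots> = autocorrelation N (\<lambda>k. s (2 * k)) m"
    using autocorrelation_shift[OF negaperiodic_decimation[OF periodic]] .
  finally show ?thesis by (simp add: autocorrelation_decimation)
qed

lemma autocorrelation_odd_reflection:
  assumes periodic: "negaperiodic (2 * N) s" and "odd w"
    and reflection: "\<And>k. s (w - k) = s k + c"
  shows "autocorrelation (2 * N) s (2 * m) = 2 * autocorrelation N (\<lambda>k. s (2 * k)) m"
proof -
  from \<open>odd w\<close> obtain l where l: "w = 2 * l + 1" by (elim oddE)
  have "s (2 * k + 1) = s (2 * (l - k)) + c" for k
    using reflection[of "2 * k + 1"] by (simp add: l algebra_simps)
  then have "autocorrelation N (\<lambda>k. s (2 * k + 1)) m = autocorrelation N (\<lambda>k. s (2 * (l - k))) m"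
    using autocorrelation_add_affine[of 0 m N "\<lambda>k. s (2 * (l - k))" c] by simp
  also have "\<dots> = autocorrelation N (\<lambda>k. s (2 * k)) m"
    using autocorrelation_reflect[OF negaperiodic_decimation[OF periodic]] .
  finally show ?thesis by (simp add: autocorrelation_decimation)
qed

locale even_shift_orthogonal =
  fixes n :: nat and s :: "int \<Rightarrow> bit"
  assumes even_n: "even n" and n_gt_2: "n > 2"
    and negaperiodic: "negaperiodic (2 * n) s"
    and even_orthogonal: "even m \<Longrightarrow> \<not> 2 * int n dvd m \<Longrightarrow> autocorrelation (2 * n) s m = 0"
begin

lemma half_period: "s (k + 2 * int n) = s k + 1"
  using negaperiodic by (simp add: negaperiodic_def)

lemma not_affine_shift: "\<not> (\<forall>k. s (k + w) = s k + of_int k + c)"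
proof
  assume shift: "\<forall>k. s (k + w) = s k + of_int k + c"
  have double: "s (k + 2 * w) = s k + of_int w" for k
    using shift[rule_format, of k] shift[rule_format, of "k + w"] by (simp add: algebra_simps)
  from autocorrelation_quasiperiod[of s, OF this] have "2 * int n dvd 2 * w"
    using even_orthogonal[of "2 * w"] n_gt_2 by fastforce
  then obtain q where q: "w = int n * q" by auto
  with even_n have "even w" by simp
  moreover have "s (2 * w) = s 0 + of_int q"
    using negaperiodic_mult[OF negaperiodic, of 0 q] q by (simp add: ac_simps)
  ultimately have "even q"
    using double[of 0] by (simp add: of_int_bit split: if_splits)
  then obtain q' where "w = int (2 * n) * q'" using q by auto
  then have "of_int k + c = of_int q'" for k
    using negaperiodic_mult[OF negaperiodic, of k q'] shift by (simp add: ac_simps)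
  from this[of 0] this[of 1] show False by simp
qed

lemma not_affine_reflection: "\<not> (\<forall>k. s (w - k) = s k + d * of_int k + c)"
proof
  assume reflection: "\<forall>k. s (w - k) = s k + d * of_int k + c"
  show False
  proof (cases "even w")
    case True
    then obtain h where h: "w = 2 * h" by blast
    have "d * of_int h + c = 0"
      using reflection[rule_format, of h] by (simp add: h add.assoc)
    moreover have "s (h - int n) + 1 = s (h + int n)"
      using half_period[of "h - int n"] by (simp add: algebra_simps)
    ultimately have "d * of_nat n = 1"
      using reflection[rule_format, of "h + int n"] by (simp add: h algebra_simps bit_add_eq_iff)
    with even_n show False by (simp add: of_nat_bit)
  next
    case False
    have "d * of_int w = 0"
      using reflection[rule_format, of 0] reflection[rule_format, of w] by (simp add: algebra_simps)
    with False have "s (w - k) = s k + c" for k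
      using reflection by (simp add: of_int_bit)
    note autocorrelation_halved = autocorrelation_odd_reflection[of n s w c, OF negaperiodic False this]
    have "\<not> 2 * int n dvd 2" "\<not> 2 * int n dvd 4"
      using n_gt_2 by (auto dest: zdvd_imp_le)
    then have "autocorrelation n (\<lambda>k. s (2 * k)) 1 = 0" "autocorrelation n (\<lambda>k. s (2 * k)) 2 = 0"
      using autocorrelation_halved[of 1] autocorrelation_halved[of 2] even_orthogonal[of 2] even_orthogonal[of 4] by simp_all
    then have "[0 = int n - 2] (mod 4)" "[0 = int n - 4] (mod 4)"
      using autocorrelation_cong_mod_4[OF negaperiodic_decimation[OF negaperiodic], of 1]
        autocorrelation_cong_mod_4[OF negaperiodic_decimation[OF negaperiodic], of 2] by simp_all
    then show False unfolding cong_def by presburger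
  qed
qed

end

section \<open>Translates of a binary function on a group\<close>

definition left_kernel :: "('a, 'x) monoid_scheme \<Rightarrow> ('a \<Rightarrow> bit) \<Rightarrow> ('a \<Rightarrow> bit) set" where
  "left_kernel G f = {t. \<forall>g\<in>carrier G. \<exists>h\<in>carrier G. \<forall>x\<in>carrier G.
     f (g \<otimes>\<^bsub>G\<^esub> x) + t x = f (h \<otimes>\<^bsub>G\<^esub> x)}"

definition left_difference :: "('a, 'x) monoid_scheme \<Rightarrow> ('a \<Rightarrow> bit) \<Rightarrow> 'a \<Rightarrow> 'a \<Rightarrow> bit" where
  "left_difference G f h x = f x + f (h \<otimes>\<^bsub>G\<^esub> x)"

definition kernel_shifts :: "('a, 'x) monoid_scheme \<Rightarrow> ('a \<Rightarrow> bit) \<Rightarrow> 'a set" where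
  "kernel_shifts G f = {h \<in> carrier G. left_difference G f h \<in> left_kernel G f}"

context group
begin

lemma left_kernelE:
  assumes "t \<in> left_kernel G f" "g \<in> carrier G"
  obtains h where "h \<in> carrier G" "\<And>x. x \<in> carrier G \<Longrightarrow> f (g \<otimes> x) + t x = f (h \<otimes> x)"
  using assms unfolding left_kernel_def by blast

lemma left_kernelI:
  assumes "\<And>g. g \<in> carrier G \<Longrightarrow> \<exists>h\<in>carrier G. \<forall>x\<in>carrier G. f (g \<otimes> x) + t x = f (h \<otimes> x)"
  shows "t \<in> left_kernel G f"
  using assms unfolding left_kernel_def by blast

lemma left_kernel_cong:
  "\<lbrakk>t \<in> left_kernel G f; \<And>x. x \<in> carrier G \<Longrightarrow> t' x = t x\<rbrakk> \<Longrightarrow> t' \<in> left_kernel G f"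
  by (simp add: left_kernel_def)

lemma left_kernel_zero: "(\<lambda>x. 0) \<in> left_kernel G f"
  by (rule left_kernelI) auto

lemma left_kernel_add:
  assumes t: "t \<in> left_kernel G f" and v: "v \<in> left_kernel G f"
  shows "(\<lambda>x. t x + v x) \<in> left_kernel G f"
proof (rule left_kernelI)
  fix g assume "g \<in> carrier G"
  with t obtain h where h: "h \<in> carrier G" "\<And>x. x \<in> carrier G \<Longrightarrow> f (g \<otimes> x) + t x = f (h \<otimes> x)"
    by (rule left_kernelE) blast
  from v h(1) obtain k where "k \<in> carrier G" "\<And>x. x \<in> carrier G \<Longrightarrow> f (h \<otimes> x) + v x = f (k \<otimes> x)"
    by (rule left_kernelE) blast
  with h show "\<exists>k\<in>carrier G. \<forall>x\<in>carrier G. f (g \<otimes> x) + (t x + v x) = f (k \<otimes> x)"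
    by (metis add.assoc)
qed

lemma left_kernel_sum:
  assumes "finite S" "\<And>i. i \<in> S \<Longrightarrow> t i \<in> left_kernel G f"
  shows "(\<lambda>x. \<Sum>i\<in>S. t i x) \<in> left_kernel G f"
  using assms by (induction S rule: finite_induct) (simp_all add: left_kernel_zero left_kernel_add)

lemma left_kernel_translate:
  assumes t: "t \<in> left_kernel G f" and g: "g \<in> carrier G"
  shows "(\<lambda>x. t (g \<otimes> x)) \<in> left_kernel G f"
proof (rule left_kernelI)
  fix k assume k: "k \<in> carrier G"
  with g have "k \<otimes> inv g \<in> carrier G" by simp
  with t obtain h where h: "h \<in> carrier G"
    "\<And>x. x \<in> carrier G \<Longrightarrow> f (k \<otimes> inv g \<otimes> x) + t x = f (h \<otimes> x)"
    by (rule left_kernelE) blast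
  have "f (k \<otimes> x) + t (g \<otimes> x) = f (h \<otimes> g \<otimes> x)" if "x \<in> carrier G" for x
  proof -
    have "k \<otimes> inv g \<otimes> (g \<otimes> x) = k \<otimes> x"
      using g k that by (simp add: inv_solve_left' m_assoc)
    then show ?thesis
      using h(2)[of "g \<otimes> x"] h(1) g that by (simp add: m_assoc)
  qed
  with h(1) g show "\<exists>h\<in>carrier G. \<forall>x\<in>carrier G. f (k \<otimes> x) + t (g \<otimes> x) = f (h \<otimes> x)"
    by blast
qed

lemma left_kernel_const:
  assumes "z \<in> carrier G" "\<And>x. x \<in> carrier G \<Longrightarrow> f (z \<otimes> x) = f x + 1"
  shows "(\<lambda>x. c) \<in> left_kernel G f"
proof (cases "c = 0")
  case False
  show ?thesis
  proof (rule left_kernelI)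
    fix g assume g: "g \<in> carrier G"
    with assms False show "\<exists>h\<in>carrier G. \<forall>x\<in>carrier G. f (g \<otimes> x) + c = f (h \<otimes> x)"
      by (intro bexI[of _ "z \<otimes> g"]) (simp_all add: m_assoc)
  qed
qed (simp add: left_kernel_zero)

lemma kernel_shifts_closed: "h \<in> kernel_shifts G f \<Longrightarrow> h \<in> carrier G"
  by (simp add: kernel_shifts_def)

lemma left_kernel_shiftE:
  assumes t: "t \<in> left_kernel G f"
  obtains h where "h \<in> kernel_shifts G f" "\<And>x. x \<in> carrier G \<Longrightarrow> t x = left_difference G f h x"
proof -
  from t one_closed obtain h where h: "h \<in> carrier G"
    "\<And>x. x \<in> carrier G \<Longrightarrow> f (\<one> \<otimes> x) + t x = f (h \<otimes> x)"
    by (rule left_kernelE) blast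
  then have diff: "t x = left_difference G f h x" if "x \<in> carrier G" for x
    using that h(2)[OF that] by (simp add: left_difference_def flip: h(2))
  have "left_difference G f h \<in> left_kernel G f"
    using left_kernel_cong[OF t diff[symmetric]] .
  with h(1) have "h \<in> kernel_shifts G f" by (simp add: kernel_shifts_def)
  then show ?thesis using diff by (rule that)
qed

lemma subgroup_kernel_shifts: "subgroup (kernel_shifts G f) G"
proof
  show "kernel_shifts G f \<subseteq> carrier G"
    by (auto simp: kernel_shifts_def)
  show "\<one> \<in> kernel_shifts G f"
    using left_kernel_cong[OF left_kernel_zero] by (simp add: kernel_shifts_def left_difference_def)
next
  fix g h assume g: "g \<in> kernel_shifts G f" and h: "h \<in> kernel_shifts G f"
  then have "(\<lambda>x. left_difference G f h x + left_difference G f g (h \<otimes> x)) \<in> left_kernel G f"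
    by (intro left_kernel_add left_kernel_translate) (auto simp: kernel_shifts_def)
  with g h show "g \<otimes> h \<in> kernel_shifts G f"
    by (auto simp: kernel_shifts_def left_difference_def m_assoc add.assoc
        elim!: left_kernel_cong)
next
  fix g assume g: "g \<in> kernel_shifts G f"
  then have "(\<lambda>x. left_difference G f g (inv g \<otimes> x)) \<in> left_kernel G f"
    by (intro left_kernel_translate) (auto simp: kernel_shifts_def)
  with g show "inv g \<in> kernel_shifts G f"
    by (auto simp: kernel_shifts_def left_difference_def add.commute
        simp flip: m_assoc elim!: left_kernel_cong)
qed

text \<open>
  The sum of \<open>f\<close> over the left translates by the powers of \<open>h\<close> is invariant under \<open>h\<close>, and if the
  order of \<open>h\<close> is odd, this sum differs from \<open>f\<close> by an element of the left kernel.
\<close>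

lemma kernel_shift_odd_order:
  assumes h: "h \<in> kernel_shifts G f" and pow: "h [^] M = \<one>" and "odd (M :: nat)"
  obtains k where "k \<in> carrier G" "\<And>x. x \<in> carrier G \<Longrightarrow> f (k \<otimes> (h \<otimes> x)) = f (k \<otimes> x)"
proof -
  note h_closed [simp] = kernel_shifts_closed[OF h]
  define u where "u x = (\<Sum>i<M. f (h [^] i \<otimes> x))" for x
  have "h [^] i \<in> kernel_shifts G f" for i :: nat
    using subgroup_int_pow_closed[OF subgroup_kernel_shifts h, of "int i"] by (simp add: int_pow_int)
  then have "(\<lambda>x. \<Sum>i<M. left_difference G f (h [^] i) x) \<in> left_kernel G f"
    by (intro left_kernel_sum) (auto simp: kernel_shifts_def)
  then obtain k where k: "k \<in> carrier G"
    "\<And>x. x \<in> carrier G \<Longrightarrow> f (\<one> \<otimes> x) + (\<Sum>i<M. left_difference G f (h [^] i) x) = f (k \<otimes> x)"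
    using one_closed by (rule left_kernelE) blast
  have u_translate: "u x = f (k \<otimes> x)" if "x \<in> carrier G" for x
    using k(2)[OF that] that \<open>odd M\<close>
    by (simp add: u_def left_difference_def sum.distrib of_nat_bit)
  have "u (h \<otimes> x) = u x" if x: "x \<in> carrier G" for x
  proof -
    have "u (h \<otimes> x) = (\<Sum>i<M. f (h [^] Suc i \<otimes> x))"
      using x by (simp add: u_def m_assoc)
    moreover have "f (h [^] (0::nat) \<otimes> x) + (\<Sum>i<M. f (h [^] Suc i \<otimes> x)) = u x + f (h [^] M \<otimes> x)"
      using sum.lessThan_Suc_shift[of "\<lambda>i. f (h [^] i \<otimes> x)" M] by (simp add: u_def del: nat_pow_Suc)
    ultimately show ?thesis using x by (simp add: pow add.commute)
  qed
  with k(1) show ?thesis by (intro that[of k]) (simp_all flip: u_translate)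
qed

lemma subgroup_int_pow_gcd:
  assumes H: "subgroup H G" and x: "x \<in> carrier G"
    and k: "x [^] k \<in> H" and l: "x [^] l \<in> H"
  shows "x [^] gcd k (l :: int) \<in> H"
proof -
  obtain u v where "u * k + v * l = gcd k l"
    using bezout_int by blast
  then have "x [^] gcd k l = (x [^] k) [^] u \<otimes> (x [^] l) [^] v"
    using x by (simp add: int_pow_pow mult.commute flip: int_pow_mult)
  then show ?thesis
    using subgroup.m_closed[OF H subgroup_int_pow_closed[OF H k] subgroup_int_pow_closed[OF H l]]
    by simp
qed

end

section \<open>Dicyclic groups\<close>

locale dicyclic_group = group G for G (structure) +
  fixes n :: nat and a b
  assumes n_pos: "n > 0"
    and a_closed [simp]: "a \<in> carrier G" and b_closed [simp]: "b \<in> carrier G"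
    and generate_ab: "generate G {a, b} = carrier G"
    and a_pow_b_square: "a [^] (2 * n) = b \<otimes> b"
    and conj_a: "inv b \<otimes> (a \<otimes> b) = inv a"
    and order_G: "order G = 8 * n"
begin

abbreviation apow :: "int \<Rightarrow> 'a" where "apow k \<equiv> a [^] k"

lemma apow_add: "apow k \<otimes> apow l = apow (k + l)"
  by (simp add: int_pow_mult)

lemma apow_mult_left: "x \<in> carrier G \<Longrightarrow> apow k \<otimes> (apow l \<otimes> x) = apow (k + l) \<otimes> x"
  by (simp add: apow_add flip: m_assoc)

lemma b_apow: "b \<otimes> apow k = apow (- k) \<otimes> b"
proof -
  have "a \<otimes> b = b \<otimes> inv a"
    using conj_a inv_solve_left[of "inv a" b "a \<otimes> b"] by simp
  then have a_conj: "b \<otimes> inv a \<otimes> inv b = a"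
    using inv_solve_right'[of a "b \<otimes> inv a" b] by (simp add: m_assoc)
  have cancel: "inv b \<otimes> (b \<otimes> y) = y" if "y \<in> carrier G" for y
    using that by (simp flip: m_assoc)
  have "b \<otimes> inv a [^] (- k) \<otimes> inv b = (b \<otimes> inv a \<otimes> inv b) [^] (- k)"
  proof (rule hom_int_pow[of "\<lambda>x. b \<otimes> x \<otimes> inv b" G G])
    show "(\<lambda>x. b \<otimes> x \<otimes> inv b) \<in> hom G G"
      by (rule homI) (simp_all add: m_assoc cancel)
  qed (simp_all add: is_group)
  then have "b \<otimes> apow k \<otimes> inv b = apow (- k)"
    by (simp add: a_conj int_pow_inv int_pow_neg)
  then show ?thesis
    using inv_solve_right'[of "apow (- k)" "b \<otimes> apow k" b] by (simp add: m_assoc)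
qed

lemma b_square: "b \<otimes> b = apow (2 * int n)"
  using a_pow_b_square int_pow_int[of G a "2 * n"] by simp

lemma apow_full [simp]: "apow (4 * int n) = \<one>"
proof -
  have "apow (2 * int n) \<otimes> b = b \<otimes> apow (2 * int n)"
    by (simp add: m_assoc flip: b_square)
  also have "\<dots> = apow (- (2 * int n)) \<otimes> b" by (rule b_apow)
  finally have "apow (2 * int n) = apow (- (2 * int n))" by simp
  then have "apow (2 * int n + 2 * int n) = apow (2 * int n + - (2 * int n))"
    by (simp only: int_pow_mult a_closed)
  then show ?thesis by simp
qed

lemma apow_mult_b: "apow k \<otimes> b \<otimes> apow l = apow (k - l) \<otimes> b"
proof -
  have "apow k \<otimes> b \<otimes> apow l = apow k \<otimes> apow (- l) \<otimes> b"
    by (simp only: m_assoc b_apow a_closed b_closed int_pow_closed)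
  then show ?thesis by (simp only: apow_add) simp
qed

lemma apow_b_mult_apow_b: "apow k \<otimes> b \<otimes> (apow l \<otimes> b) = apow (k - l + 2 * int n)"
proof -
  have "apow k \<otimes> b \<otimes> (apow l \<otimes> b) = apow (k - l) \<otimes> (b \<otimes> b)"
    by (simp add: apow_mult_b m_assoc flip: m_assoc[of _ "apow l" b])
  then show ?thesis by (simp only: apow_add b_square)
qed

lemma carrier_cases:
  assumes "x \<in> carrier G"
  obtains (apow) k where "x = apow k" | (apow_b) k where "x = apow k \<otimes> b"
proof -
  have "x \<in> generate G {a, b}" using assms generate_ab by simp
  then have "(\<exists>k. x = apow k) \<or> (\<exists>k. x = apow k \<otimes> b)"
  proof (induction rule: generate.induct)
    case one
    show ?case by (intro disjI1 exI[of _ 0]) simp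
  next
    case (incl h)
    then have "h = apow 1 \<or> h = apow 0 \<otimes> b" by auto
    then show ?case by blast
  next
    case (inv h)
    have "inv b = apow (- 2 * int n) \<otimes> b"
      by (rule inv_equality) (use apow_b_mult_apow_b[of "- 2 * int n" 0] in simp_all)
    moreover have "inv a = apow (- 1)" by (simp add: int_pow_neg)
    ultimately show ?case using inv by auto
  next
    case (eng h1 h2)
    then show ?case
      by (elim disjE exE; simp only: apow_mult_b apow_b_mult_apow_b a_closed b_closed int_pow_closed
          flip: int_pow_mult m_assoc; blast)
  qed
  with that show ?thesis by blast
qed

lemma finite_carrier: "finite (carrier G)"
  using order_G n_pos by (intro card_ge_0_finite) (simp add: order_def)

lemma card_range_apow: "card (range apow) = ord a"
  using generate_pow_card[OF a_closed] generate_pow[OF a_closed]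
  by (simp add: full_SetCompr_eq)

lemma carrier_eq: "carrier G = range apow \<union> (\<lambda>x. x \<otimes> b) ` range apow"
  by (auto elim: carrier_cases)

lemma ord_a: "ord a = 4 * n"
proof -
  have "8 * n \<le> card (range apow) + card ((\<lambda>x. x \<otimes> b) ` range apow)"
    using card_Un_le[of "range apow" "(\<lambda>x. x \<otimes> b) ` range apow"] order_G carrier_eq
    by (simp add: order_def)
  also have "\<dots> \<le> ord a + ord a"
    using card_image_le[of "range apow" "\<lambda>x. x \<otimes> b"] finite_subset[OF _ finite_carrier, of "range apow"]
    by (simp add: card_range_apow image_subset_iff)
  finally have "4 * n \<le> ord a" by simp
  moreover have "ord a dvd 4 * n"
    using apow_full int_pow_int[of G a "4 * n"] by (simp flip: pow_eq_id)
  ultimately show ?thesis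
    using n_pos by (simp add: dvd_imp_le le_antisym)
qed

lemma apow_eq_iff: "apow k = apow l \<longleftrightarrow> 4 * int n dvd k - l"
  using int_pow_eq[OF a_closed, of l k] by (auto simp: ord_a)

lemma apow_eq_one_iff: "apow k = \<one> \<longleftrightarrow> 4 * int n dvd k"
  using apow_eq_iff[of k 0] by simp

lemma apow_half_neq_one: "apow (2 * int n) \<noteq> \<one>"
  using n_pos by (auto simp: apow_eq_one_iff dest: zdvd_imp_le)

lemma apow_in_center_iff: "apow k \<in> {\<one>, apow (2 * int n)} \<longleftrightarrow> 2 * int n dvd k"
proof
  assume "apow k \<in> {\<one>, apow (2 * int n)}"
  then have "4 * int n dvd k \<or> 4 * int n dvd k - 2 * int n"
    by (auto simp: apow_eq_one_iff apow_eq_iff)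
  then have "2 * int n dvd k \<or> 2 * int n dvd k - 2 * int n"
    using dvd_trans[of "2 * int n" "4 * int n"] by auto
  then show "2 * int n dvd k"
    using dvd_add[of "2 * int n" "k - 2 * int n" "2 * int n"] by auto
next
  assume "2 * int n dvd k"
  then obtain q where q: "k = 2 * int n * q" by blast
  show "apow k \<in> {\<one>, apow (2 * int n)}"
  proof (cases "even q")
    case True
    then show ?thesis using q by (auto simp: apow_eq_one_iff)
  next
    case False
    then obtain q' where "q = 2 * q' + 1" by (elim oddE)
    then have "k - 2 * int n = 4 * int n * q'" using q by (simp add: algebra_simps)
    then show ?thesis by (simp add: apow_eq_iff)
  qed
qed

lemma involution_cases:
  assumes x: "x \<in> carrier G" "x \<otimes> x = \<one>"
  shows "x \<in> {\<one>, apow (2 * int n)}"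
  using x(1)
proof (cases rule: carrier_cases)
  case (apow k)
  with x(2) have "4 * int n dvd 2 * k" by (simp add: apow_add apow_eq_one_iff)
  then have "2 * int n dvd k" by auto
  then show ?thesis using apow apow_in_center_iff by blast
next
  case (apow_b k)
  with x(2) show ?thesis by (simp add: apow_b_mult_apow_b apow_half_neq_one)
qed

lemma conj_apowE:
  assumes "x \<in> carrier G"
  obtains l where "l = k \<or> l = - k" "x \<otimes> apow k = apow l \<otimes> x"
  using assms
proof (cases rule: carrier_cases)
  case (apow m)
  with that[of k] show ?thesis by (simp add: apow_add add.commute)
next
  case (apow_b m)
  with that[of "- k"] show ?thesis
    by (simp add: apow_mult_b flip: m_assoc) (simp add: apow_add)
qed

lemma sum_carrier:
  fixes F :: "'a \<Rightarrow> int"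
  shows "(\<Sum>x\<in>carrier G. F x) = (\<Sum>i<4 * n. F (apow (int i))) + (\<Sum>i<4 * n. F (apow (int i) \<otimes> b))"
proof -
  have inj: "inj_on (\<lambda>i. apow (int i)) {..<4 * n}"
    by (auto simp: inj_on_def apow_eq_iff simp flip: mod_eq_dvd_iff)
  have inj_b: "inj_on (\<lambda>x. x \<otimes> b) (range apow)"
    by (auto intro: inj_onI)
  have range: "range apow = (\<lambda>i. apow (int i)) ` {..<4 * n}"
  proof (rule card_subset_eq[symmetric])
    show "finite (range apow)"
      using finite_carrier by (rule finite_subset[rotated]) auto
  qed (auto simp: card_image[OF inj] card_range_apow ord_a)
  have "card (range apow \<inter> (\<lambda>x. x \<otimes> b) ` range apow) = 0"
    using card_Un_Int[of "range apow" "(\<lambda>x. x \<otimes> b) ` range apow"] order_G carrier_eq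
      card_image[OF inj_b] finite_carrier
    by (simp add: order_def card_range_apow ord_a)
  then have "(\<Sum>x\<in>carrier G. F x) = (\<Sum>x\<in>range apow. F x) + (\<Sum>x\<in>(\<lambda>x. x \<otimes> b) ` range apow. F x)"
    using finite_carrier unfolding carrier_eq by (intro sum.union_disjoint) auto
  also have "(\<Sum>x\<in>(\<lambda>x. x \<otimes> b) ` range apow. F x) = (\<Sum>x\<in>range apow. F (x \<otimes> b))"
    by (simp add: sum.reindex[OF inj_b])
  finally show ?thesis
    unfolding range by (simp add: sum.reindex[OF inj])
qed

lemma dicyclic_group_apow_b: "dicyclic_group G n a (apow p \<otimes> b)"
proof unfold_locales
  let ?c = "apow p \<otimes> b"
  show "generate G {a, ?c} = carrier G"
  proof (rule antisym)
    show "generate G {a, ?c} \<subseteq> carrier G"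
      by (intro generate_incl) auto
    interpret H: subgroup "generate G {a, ?c}" G
      by (intro generate_is_subgroup) auto
    have "a \<in> generate G {a, ?c}" "?c \<in> generate G {a, ?c}"
      by (simp_all add: generate.incl)
    then have "apow (- p) \<otimes> ?c \<in> generate G {a, ?c}"
      by (rule H.m_closed[OF subgroup_int_pow_closed[OF H.subgroup_axioms]])
    also have "apow (- p) \<otimes> ?c = apow (- p) \<otimes> apow p \<otimes> b"
      by (simp add: m_assoc)
    also have "\<dots> = b"
      by (simp only: apow_add) simp
    finally have "{a, b} \<subseteq> generate G {a, ?c}"
      using generate.incl[of a "{a, ?c}" G] by auto
    then show "carrier G \<subseteq> generate G {a, ?c}"
      using generate_subgroup_incl[OF _ H.subgroup_axioms] generate_ab by blast
  qed
  show "a [^] (2 * n) = ?c \<otimes> ?c"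
    using apow_b_mult_apow_b[of p p] a_pow_b_square b_square by simp
  have "?c \<otimes> apow (- 1) = apow 1 \<otimes> apow p \<otimes> b"
    unfolding apow_mult_b apow_add by (simp add: add.commute)
  then have "?c \<otimes> inv a = a \<otimes> ?c"
    by (simp add: int_pow_neg m_assoc)
  then show "inv ?c \<otimes> (a \<otimes> ?c) = inv a"
    by (simp add: inv_solve_left')
qed (simp_all add: n_pos order_G)

end

section \<open>Orthogonal translates on dicyclic groups\<close>

locale hadamard_dicyclic_group = dicyclic_group +
  fixes f :: "'a \<Rightarrow> bit"
  assumes f_half: "x \<in> carrier G \<Longrightarrow> f (apow (2 * int n) \<otimes> x) = f x + 1"
    and right_orthogonal: "\<lbrakk>g \<in> carrier G; g \<notin> {\<one>, apow (2 * int n)}\<rbrakk> \<Longrightarrow>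
      (\<Sum>x\<in>carrier G. bit_sign (f x + f (x \<otimes> g))) = 0"
begin

definition coset_sequence :: "'a \<Rightarrow> int \<Rightarrow> bit" where
  "coset_sequence g k = f (apow k \<otimes> g)"

lemma negaperiodic_coset_sequence:
  assumes "g \<in> carrier G"
  shows "negaperiodic (2 * n) (coset_sequence g)"
proof -
  have "f (apow (k + 2 * int n) \<otimes> g) = f (apow k \<otimes> g) + 1" for k
    using f_half[of "apow k \<otimes> g"] assms by (simp add: apow_mult_left add.commute)
  then show ?thesis by (simp add: negaperiodic_def coset_sequence_def)
qed

lemma f_half_mult:
  "x \<in> carrier G \<Longrightarrow> f (apow (2 * int n * q) \<otimes> x) = f x + of_int q"
  using negaperiodic_mult[OF negaperiodic_coset_sequence, of x 0 q]
  by (simp add: coset_sequence_def)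

lemma autocorrelation_coset_sequences:
  assumes "\<not> 2 * int n dvd m"
  shows "autocorrelation (2 * n) (coset_sequence \<one>) m
    + autocorrelation (2 * n) (coset_sequence b) m = 0"
proof -
  let ?s = "coset_sequence \<one>" and ?r = "coset_sequence b"
  have "(\<Sum>x\<in>carrier G. bit_sign (f x + f (x \<otimes> apow m))) = 0"
    using assms apow_in_center_iff by (intro right_orthogonal) auto
  then have "autocorrelation (2 * (2 * n)) ?s m + autocorrelation (2 * (2 * n)) ?r (- m) = 0"
    by (simp add: sum_carrier autocorrelation_def coset_sequence_def apow_add apow_mult_b)
  then show ?thesis
    by (simp only: autocorrelation_double autocorrelation_minus negaperiodic_coset_sequence
        one_closed b_closed)
qed

lemma left_quasiperiod:
  assumes "\<And>x. x \<in> carrier G \<Longrightarrow> f (apow m \<otimes> x) = f x + c"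
  shows "2 * int n dvd m"
proof (rule ccontr)
  have "autocorrelation N (coset_sequence g) m = int N * bit_sign c" if "g \<in> carrier G" for g N
  proof (rule autocorrelation_quasiperiod)
    show "coset_sequence g (k + m) = coset_sequence g k + c" for k
      using assms[of "apow k \<otimes> g"] that
      by (simp add: coset_sequence_def apow_mult_left add.commute)
  qed
  moreover assume "\<not> 2 * int n dvd m"
  ultimately have "int (2 * n) * bit_sign c + int (2 * n) * bit_sign c = 0"
    using autocorrelation_coset_sequences[of m] by simp
  then show False using n_pos by simp
qed

lemma right_quasiperiod:
  assumes "g \<in> carrier G" "\<And>x. x \<in> carrier G \<Longrightarrow> f (x \<otimes> g) = f x + c"
  shows "g \<in> {\<one>, apow (2 * int n)}"
proof (rule ccontr)
  assume "g \<notin> {\<one>, apow (2 * int n)}"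
  from right_orthogonal[OF assms(1) this] have "int (order G) * bit_sign c = 0"
    by (simp add: assms(2) order_def)
  then show False using order_G n_pos by simp
qed

lemma hadamard_dicyclic_group_apow_b: "hadamard_dicyclic_group G n a (apow p \<otimes> b) f"
  by (intro hadamard_dicyclic_group.intro hadamard_dicyclic_group_axioms.intro
      dicyclic_group_apow_b f_half right_orthogonal)

end

locale dicyclic_kernel_character = hadamard_dicyclic_group +
  fixes \<psi> :: "'a \<Rightarrow> bit" and h
  assumes \<psi>_mult: "\<lbrakk>x \<in> carrier G; y \<in> carrier G\<rbrakk> \<Longrightarrow> \<psi> (x \<otimes> y) = \<psi> x + \<psi> y"
    and h_closed [simp]: "h \<in> carrier G"
    and h_not_central: "h \<notin> {\<one>, apow (2 * int n)}"
    and f_mult_h: "x \<in> carrier G \<Longrightarrow> f (x \<otimes> h) = f x + \<psi> x"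
    and n_gt_1: "n > 1"
begin

lemma \<psi>_apow: "\<psi> (apow k) = \<psi> a * of_int k"
proof -
  have "\<psi> \<one> = 0" using \<psi>_mult[of \<one> \<one>] by (simp add: bit_add_eq_iff)
  moreover have "\<psi> (apow (k + 1)) = \<psi> (apow k) + \<psi> a" for k
    using \<psi>_mult[of "apow k" a] by (simp add: apow_add[of k 1, simplified])
  ultimately show ?thesis
    using int_affine[of "\<lambda>k. \<psi> (apow k)" "\<psi> a" k] by (simp add: mult.commute)
qed

lemma h_square: "h \<otimes> h = apow (2 * int n)" and \<psi>_h: "\<psi> h = 1"
proof -
  have f_mult_h_square: "f (x \<otimes> (h \<otimes> h)) = f x + \<psi> h" if "x \<in> carrier G" for x
    using that f_mult_h[of "x \<otimes> h"] f_mult_h[of x] \<psi>_mult[of x h]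
    by (simp add: add.assoc flip: m_assoc)
  then have "h \<otimes> h \<in> {\<one>, apow (2 * int n)}"
    by (intro right_quasiperiod) simp_all
  moreover have "h \<otimes> h \<noteq> \<one>"
    using involution_cases[OF h_closed] h_not_central by blast
  ultimately show "h \<otimes> h = apow (2 * int n)" by simp
  then show "\<psi> h = 1"
    using f_mult_h_square[OF one_closed] f_half[OF one_closed] by simp
qed

lemma h_not_apow: "h \<noteq> apow k"
proof
  assume h: "h = apow k"
  let ?s = "coset_sequence \<one>" and ?r = "coset_sequence b"
  have "\<psi> a * of_int k = 1" using \<psi>_h by (simp add: h \<psi>_apow)
  then have \<psi>_a: "\<psi> a = 1" and "odd k" by (auto simp: of_int_bit split: if_splits)
  have "apow (2 * k) = apow (2 * int n)"
    using h_square by (simp add: h apow_add)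
  then obtain q where "2 * k - 2 * int n = 4 * int n * q"
    unfolding apow_eq_iff by blast
  then have "k = int n * (1 + 2 * q)" by (simp add: algebra_simps)
  with \<open>odd k\<close> have "odd n" by simp
  have s_shift: "?s (i + k) = ?s i + of_int i + 0" for i
    using f_mult_h[of "apow i"] by (simp add: coset_sequence_def h apow_add \<psi>_apow \<psi>_a)
  have r_shift: "?r (i + k) = ?r i + of_int i + (1 + \<psi> b)" for i
  proof -
    have "?r i = ?r (i + k) + \<psi> (apow (i + k) \<otimes> b)"
      using f_mult_h[of "apow (i + k) \<otimes> b"] by (simp add: coset_sequence_def h apow_mult_b)
    also have "\<psi> (apow (i + k) \<otimes> b) = of_int i + (1 + \<psi> b)"
      using \<open>odd k\<close> \<psi>_mult[of "apow (i + k)" b] by (simp add: \<psi>_apow \<psi>_a of_int_bit[of k])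
    finally show ?thesis by (simp add: bit_add_eq_iff add.assoc)
  qed
  have halved: "autocorrelation (2 * n) (coset_sequence g) 2
      = 2 * autocorrelation n (\<lambda>i. coset_sequence g (2 * i)) 1"
    "[autocorrelation n (\<lambda>i. coset_sequence g (2 * i)) 1 = int n - 2] (mod 4)"
    if "g \<in> carrier G" "\<And>i. coset_sequence g (i + k) = coset_sequence g i + of_int i + c" for g c
    using autocorrelation_odd_shift[OF negaperiodic_coset_sequence \<open>odd k\<close>, of g c 1]
      autocorrelation_cong_mod_4[OF negaperiodic_decimation[OF negaperiodic_coset_sequence], of g 1] that
    by auto
  have "\<not> 2 * int n dvd 2" using n_gt_1 by (auto dest: zdvd_imp_le)
  then have "autocorrelation n (\<lambda>i. ?s (2 * i)) 1 + autocorrelation n (\<lambda>i. ?r (2 * i)) 1 = 0"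
    using autocorrelation_coset_sequences[of 2] halved(1)[OF one_closed s_shift] halved(1)[OF b_closed r_shift]
    by simp
  then have "[0 = 2 * (int n - 2)] (mod 4)"
    using cong_add[OF halved(2)[OF one_closed s_shift] halved(2)[OF b_closed r_shift]] by simp
  with \<open>odd n\<close> show False unfolding cong_def by presburger
qed

theorem h_normal_form:
  obtains p where "h = apow p \<otimes> b" "even n" "\<And>k. f (apow k \<otimes> h) = f (apow k) + of_int k"
proof -
  from h_closed obtain p where h: "h = apow p \<otimes> b"
    by (cases rule: carrier_cases) (use h_not_apow in auto)
  interpret h: hadamard_dicyclic_group G n a h f
    unfolding h by (rule hadamard_dicyclic_group_apow_b)
  let ?s = "coset_sequence \<one>"
  have f_apow_h: "f (apow k \<otimes> h) = f (apow k) + \<psi> a * of_int k" for k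
    using f_mult_h[of "apow k"] by (simp add: \<psi>_apow)
  have autocorrelation_zero: "autocorrelation (2 * n) ?s m = 0"
    if "\<not> 2 * int n dvd m" "\<psi> a * of_int m = 0" for m
  proof -
    have "coset_sequence h k = ?s k + (0 + \<psi> a * of_int k)" for k
      by (simp add: coset_sequence_def f_apow_h)
    then have "autocorrelation (2 * n) (coset_sequence h) m = autocorrelation (2 * n) ?s m"
      using autocorrelation_add_affine[OF that(2), of "2 * n" ?s 0] by presburger
    then show ?thesis
      using h.autocorrelation_coset_sequences[OF that(1)] by simp
  qed
  have autocorrelation_cong: "[autocorrelation (2 * n) ?s m = int (2 * n) - 2 * m] (mod 4)" for m
    by (intro autocorrelation_cong_mod_4 negaperiodic_coset_sequence one_closed)
  have not_dvd: "\<not> 2 * int n dvd 1" "\<not> 2 * int n dvd 2"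
    using n_gt_1 by (auto dest: zdvd_imp_le)
  have "even n"
    using autocorrelation_cong[of 2] autocorrelation_zero[OF not_dvd(2)] unfolding cong_def by simp presburger
  moreover have "\<psi> a = 1"
  proof (rule ccontr)
    assume "\<psi> a \<noteq> 1"
    then have "odd n"
      using autocorrelation_cong[of 1] autocorrelation_zero[OF not_dvd(1)] unfolding cong_def by simp presburger
    with \<open>even n\<close> show False by simp
  qed
  ultimately show ?thesis using that[OF h] f_apow_h by simp
qed

end


locale twisted_dicyclic_group = hadamard_dicyclic_group +
  assumes n_even: "even n" and two_less_n: "2 < n"
    and f_apow_b: "f (apow k \<otimes> b) = f (apow k) + of_int k"
begin

sublocale even_shift_orthogonal n "\<lambda>k. f (apow k)"
proof
  let ?s = "coset_sequence \<one>"
  have s: "(\<lambda>k. f (apow k)) = ?s" by (simp add: coset_sequence_def fun_eq_iff)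
  show "even n" "n > 2" by (fact n_even two_less_n)+
  show "negaperiodic (2 * n) (\<lambda>k. f (apow k))"
    unfolding s by (simp add: negaperiodic_coset_sequence)
  fix m assume m: "even m" "\<not> 2 * int n dvd m"
  have "coset_sequence b = (\<lambda>k. ?s k + (0 + 1 * of_int k))"
    by (simp add: coset_sequence_def f_apow_b fun_eq_iff)
  then have "autocorrelation (2 * n) (coset_sequence b) m = autocorrelation (2 * n) ?s m"
    using m(1) by (simp only:) (intro autocorrelation_add_affine, simp add: of_int_bit)
  then show "autocorrelation (2 * n) (\<lambda>k. f (apow k)) m = 0"
    unfolding s using autocorrelation_coset_sequences[OF m(2)] by simp
qed

lemma const_mem_left_kernel: "(\<lambda>x. c) \<in> left_kernel G f"
  by (rule left_kernel_const[of "apow (2 * int n)"]) (simp_all add: f_half)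

lemma left_difference_half:
  assumes "h \<in> carrier G" "x \<in> carrier G"
  shows "left_difference G f (apow (2 * int n * q) \<otimes> h) x = left_difference G f h x + of_int q"
  using assms f_half_mult[of "h \<otimes> x" q] by (simp add: left_difference_def m_assoc add.assoc)

lemma left_difference_affine:
  assumes "h \<in> carrier G" "\<And>k. left_difference G f h (apow k) = c + d * of_int k"
  shows "d = 0" "h \<in> range apow"
proof -
  have f_h: "f (h \<otimes> apow k) = f (apow k) + (c + d * of_int k)" for k
    using assms(2)[of k] by (simp add: left_difference_def bit_add_eq_iff add.commute)
  from assms(1) have "d = 0 \<and> h \<in> range apow"
  proof (cases rule: carrier_cases)
    case (apow w)
    have "d \<noteq> 1"
    proof
      assume "d = 1"
      with f_h have "\<forall>k. f (apow (k + w)) = f (apow k) + of_int k + c"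
        by (simp add: apow apow_add ac_simps)
      then show False using not_affine_shift by blast
    qed
    with apow show ?thesis by simp
  next
    case (apow_b w)
    have "f (apow (w - k)) = f (apow k) + (1 + d) * of_int k + (c + of_int w)" for k
      using arg_cong[OF f_h[of k], of "\<lambda>x. x + of_int (w - k)"]
      by (simp add: apow_b apow_mult_b f_apow_b algebra_simps)
    then show ?thesis using not_affine_reflection by blast
  qed
  then show "d = 0" "h \<in> range apow" by simp_all
qed

lemma apow_half_mem_kernel_shifts: "apow (2 * int n) \<in> kernel_shifts G f"
  unfolding kernel_shifts_def
  using left_kernel_cong[OF const_mem_left_kernel[of 1]] left_difference_half[OF one_closed, of _ 1]
  by (simp add: left_difference_def)

lemma kernel_shift_odd_order_dvd:
  assumes "apow w \<in> kernel_shifts G f" "apow w [^] M = \<one>" "odd (M :: nat)"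
  shows "2 * int n dvd w"
proof -
  from assms obtain k where k: "k \<in> carrier G"
    "\<And>x. x \<in> carrier G \<Longrightarrow> f (k \<otimes> (apow w \<otimes> x)) = f (k \<otimes> x)"
    by (rule kernel_shift_odd_order) blast
  obtain l where l: "l = w \<or> l = - w" "k \<otimes> apow w = apow l \<otimes> k"
    using k(1) by (rule conj_apowE)
  have "f (apow l \<otimes> y) = f y + 0" if "y \<in> carrier G" for y
  proof -
    define x where "x = inv k \<otimes> y"
    have x: "x \<in> carrier G" "y = k \<otimes> x"
      using k(1) that by (simp_all add: x_def flip: m_assoc)
    have "apow l \<otimes> y = k \<otimes> (apow w \<otimes> x)"
      using k(1) x by (simp add: l(2) flip: m_assoc)
    then show ?thesis using k(2)[OF x(1)] x(2) by simp
  qed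
  then have "2 * int n dvd l" by (rule left_quasiperiod)
  with l(1) show ?thesis by auto
qed

lemma apow_n_mem_kernel_shifts:
  assumes w: "apow w \<in> kernel_shifts G f" and not_dvd: "\<not> 2 * int n dvd w"
  shows "apow (int n) \<in> kernel_shifts G f"
proof -
  define d where "d = nat (gcd w (2 * int n))"
  have d: "int d = gcd w (2 * int n)" by (simp add: d_def)
  have "apow (int d) \<in> kernel_shifts G f"
    unfolding d using subgroup_kernel_shifts a_closed w apow_half_mem_kernel_shifts
    by (rule subgroup_int_pow_gcd)
  then have multiples_mem: "apow (int d * k) \<in> kernel_shifts G f" for k
    using subgroup_int_pow_closed[OF subgroup_kernel_shifts, of "apow (int d)" f k]
    by (simp add: int_pow_pow)
  have "int d dvd int (2 * n)" by (simp add: d)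
  then obtain M where M: "2 * n = d * M" unfolding int_dvd_int_iff by blast
  have "even M"
  proof (rule ccontr)
    assume "odd M"
    have "apow (int d * 2) [^] M = apow (2 * int (d * M))"
      using int_pow_int[of G "apow (int d * 2)" M] by (simp add: int_pow_pow ac_simps)
    also have "\<dots> = \<one>" unfolding M[symmetric] by simp
    finally have "2 * int n dvd int d * 2"
      using multiples_mem \<open>odd M\<close> by (intro kernel_shift_odd_order_dvd)
    then have "int (d * M) dvd int (d * 2)"
      unfolding M[symmetric] by simp
    then have "d * M dvd d * 2" by (simp only: int_dvd_int_iff)
    then have "M dvd 2" using M n_pos by (cases "d = 0") auto
    with \<open>odd M\<close> have "M = 1" using coprime_absorb_left[of M 2] by simp
    with M have "int d = 2 * int n" by simp
    then have "2 * int n dvd w" using gcd_dvd1[of w "2 * int n"] d by simp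
    with not_dvd show False ..
  qed
  then obtain l where "M = 2 * l" by blast
  with M have "n = d * l" by simp
  then show ?thesis using multiples_mem by simp
qed

lemma left_kernel_slope_one:
  assumes "apow (int n) \<in> kernel_shifts G f"
  obtains v where "v \<in> left_kernel G f" "\<And>k. v (apow k) = v \<one> + of_int k"
proof -
  define t where "t = left_difference G f (apow (int n))"
  define v where "v x = (\<Sum>i<n. t (apow (int i) \<otimes> x))" for x
  have "t \<in> left_kernel G f" using assms by (simp add: kernel_shifts_def t_def)
  then have "(\<lambda>x. \<Sum>i<n. t (apow (int i) \<otimes> x)) \<in> left_kernel G f"
    by (intro left_kernel_sum left_kernel_translate) simp_all
  then have "v \<in> left_kernel G f" by (simp add: v_def[abs_def])
  moreover have "v (apow k) = v \<one> + of_int k" for k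
  proof -
    have "t (apow (k + int n)) = t (apow k) + 1" for k
      using half_period[of k] by (simp add: t_def left_difference_def apow_add algebra_simps)
    from sum_quasiperiodic_shift[of "\<lambda>k. t (apow k)", OF this, of k]
    show ?thesis by (simp add: v_def apow_add)
  qed
  ultimately show ?thesis by (rule that)
qed

lemma apow_mem_kernel_shifts_dvd:
  assumes "apow w \<in> kernel_shifts G f"
  shows "2 * int n dvd w"
proof (rule ccontr)
  assume "\<not> 2 * int n dvd w"
  with assms have "apow (int n) \<in> kernel_shifts G f" by (rule apow_n_mem_kernel_shifts)
  then obtain v where v: "v \<in> left_kernel G f" "\<And>k. v (apow k) = v \<one> + of_int k"
    by (rule left_kernel_slope_one) blast
  from v(1) obtain h where h: "h \<in> kernel_shifts G f"
    "\<And>x. x \<in> carrier G \<Longrightarrow> v x = left_difference G f h x"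
    by (rule left_kernel_shiftE) blast
  then have "left_difference G f h (apow k) = v \<one> + 1 * of_int k" for k
    using v(2)[of k] by simp
  from left_difference_affine(1)[OF kernel_shifts_closed[OF h(1)] this] show False by simp
qed

lemma kernel_shift_difference_step:
  assumes h: "h \<in> kernel_shifts G f" "h = apow w \<otimes> b"
  obtains d where "\<And>k. left_difference G f h (apow (k + 1)) = left_difference G f h (apow k) + d"
proof -
  let ?t = "left_difference G f h"
  note h_closed = kernel_shifts_closed[OF h(1)]
  have "(\<lambda>x. ?t (apow 1 \<otimes> x)) \<in> left_kernel G f"
    using h by (intro left_kernel_translate) (simp_all add: kernel_shifts_def)
  then obtain g where g: "g \<in> kernel_shifts G f"
    "\<And>x. x \<in> carrier G \<Longrightarrow> ?t (apow 1 \<otimes> x) = left_difference G f g x"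
    by (rule left_kernel_shiftE) blast
  then have step: "?t (apow (k + 1)) = left_difference G f g (apow k)" for k
    using g(2)[of "apow k"] by (simp only: apow_add int_pow_closed a_closed add.commute)
  from kernel_shifts_closed[OF g(1)] show ?thesis
  proof (cases rule: carrier_cases)
    case (apow w')
    then obtain q where q: "w' = 2 * int n * q"
      using apow_mem_kernel_shifts_dvd g(1) by blast
    have "left_difference G f g (apow k) = of_int q" for k
      using left_difference_half[OF one_closed, of "apow k" q] by (simp add: apow q left_difference_def)
    then have "?t (apow k) = of_int q" for k
      using step[of "k - 1"] by simp
    then show ?thesis using that[of 0] by simp
  next
    case (apow_b w')
    have "g = apow (w' - w) \<otimes> h"
      by (simp add: apow_b h(2) apow_mult_left)
    moreover from this have "apow (w' - w) = g \<otimes> inv h"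
      using h_closed by (simp add: m_assoc)
    then have "apow (w' - w) \<in> kernel_shifts G f"
      using g(1) h(1) subgroup_kernel_shifts
      by (auto intro: subgroup.m_closed subgroup.m_inv_closed)
    then obtain q where "w' - w = 2 * int n * q"
      using apow_mem_kernel_shifts_dvd by blast
    ultimately have "left_difference G f g (apow k) = ?t (apow k) + of_int q" for k
      using left_difference_half[OF h_closed, of "apow k" q] by simp
    then show ?thesis using that step by simp
  qed
qed

lemma kernel_shifts_subset_range_apow: "kernel_shifts G f \<subseteq> range apow"
proof
  fix h assume h: "h \<in> kernel_shifts G f"
  note h_closed = kernel_shifts_closed[OF h]
  from h_closed show "h \<in> range apow"
  proof (cases rule: carrier_cases)
    case (apow_b w)
    with h obtain d where
      "\<And>k. left_difference G f h (apow (k + 1)) = left_difference G f h (apow k) + d"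
      by (rule kernel_shift_difference_step) blast
    from int_affine[of "\<lambda>k. left_difference G f h (apow k)", OF this]
    have "left_difference G f h (apow k) = left_difference G f h \<one> + d * of_int k" for k
      by (simp add: mult.commute)
    then show ?thesis by (rule left_difference_affine(2)[OF h_closed])
  qed simp
qed

theorem left_kernel_trivial:
  assumes "t \<in> left_kernel G f"
  shows "\<exists>c. \<forall>x\<in>carrier G. t x = c"
proof -
  from assms obtain h where h: "h \<in> kernel_shifts G f"
    "\<And>x. x \<in> carrier G \<Longrightarrow> t x = left_difference G f h x"
    by (rule left_kernel_shiftE) blast
  then obtain w where "h = apow w" using kernel_shifts_subset_range_apow by blast
  with h(1) obtain q where "h = apow (2 * int n * q)"
    using apow_mem_kernel_shifts_dvd by blast
  then have "t x = of_int q" if "x \<in> carrier G" for x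
    using left_difference_half[OF one_closed that, of q] h(2)[OF that] that
    by (simp add: left_difference_def)
  then show ?thesis by blast
qed

end

section \<open>Binary Hadamard codes\<close>

lemma bit_vec_add_self [simp]: "x + x = (0 :: bit ^ 'm)"
  by (simp add: vec_eq_iff)

lemma bit_vec_add_self_left [simp]: "x + (x + y) = (y :: bit ^ 'm)"
  by (simp flip: add.assoc)

lemma bit_vec_add_self_right [simp]: "x + y + y = (x :: bit ^ 'm)"
  by (simp add: add.assoc)

lemma bit_vec_add_eq_iff: "x + y = z \<longleftrightarrow> x = z + (y :: bit ^ 'm)"
  by auto

lemma bit_vec_add_zero_one_iff: "x + y \<in> {0, 1 :: bit ^ 'm} \<longleftrightarrow> x = y \<or> x = y + 1"
  by (simp add: bit_vec_add_eq_iff[of x y] add.commute)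

lemma UNIV_bit: "(UNIV :: bit set) = {0, 1}"
  using bit.exhaust by blast

lemma vec_one_bit [simp]: "vec 1 = (1 :: bit ^ 'm)"
  by (simp add: vec_eq_iff)

lemma vec_bit_cases: "vec c \<in> {0, 1 :: bit ^ 'm}"
  by (cases c) simp_all

lemma span_singleton_bit: "vec.span {u :: bit ^ 'm} = {0, u}"
proof -
  have "range (\<lambda>k. k *s u) = (\<lambda>k. k *s u) ` {0, 1}"
    by (rule arg_cong[of _ _ "image _"]) auto
  then show ?thesis by (simp add: vec.span_singleton)
qed

lemma dim_zero_one_bit: "vec.dim {0, 1 :: bit ^ 'm} = 1"
proof -
  have "vec.independent {1 :: bit ^ 'm}" by (simp add: vec.dependent_single)
  from vec.dim_eq_card_independent[OF this] show ?thesis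
    using vec.dim_span[of "{1 :: bit ^ 'm}"] by (simp add: span_singleton_bit)
qed

lemma bit_subspace_dim_2:
  fixes K :: "(bit ^ 'm) set"
  assumes "vec.subspace K" "vec.dim K = 2" "u \<in> K" "u \<noteq> 0"
  obtains z where "z \<notin> {0, u}" "K = {0, u, z, z + u}"
proof -
  have "vec.independent {u}" using \<open>u \<noteq> 0\<close> by (simp add: vec.dependent_single)
  with \<open>u \<in> K\<close> obtain B where B: "{u} \<subseteq> B" "B \<subseteq> K" "vec.independent B" "K \<subseteq> vec.span B"
    using vec.maximal_independent_subset_extend[of "{u}" K] by auto
  then have K_eq_span: "K = vec.span B"
    using vec.span_minimal[OF B(2) assms(1)] by blast
  have "card B = 2"
    using vec.basis_card_eq_dim[OF B(2,4,3)] assms(2) by simp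
  then obtain z where z: "B = {z, u}" "z \<noteq> u"
    using B(1) by (auto simp: card_2_iff)
  have "z \<noteq> 0" using B(3) z vec.dependent_zero by blast
  moreover have "K = {0, u, z, z + u}"
  proof -
    have "x \<in> {0, u, z, z + u}" if "x - k *s z \<in> {0, u}" for x k
      using that by (cases k) (auto simp: diff_eq_eq add.commute)
    moreover have "{0, u, z, z + u} \<subseteq> vec.span {z, u}"
      by (auto intro: vec.span_base vec.span_add vec.span_zero)
    ultimately show ?thesis
      unfolding K_eq_span z(1) by (auto simp: vec.span_insert[of z] span_singleton_bit)
  qed
  ultimately show ?thesis using z(2) by (intro that) auto
qed

lemma with_complements_add_one: "x \<in> with_complements S \<Longrightarrow> x + 1 \<in> with_complements S"
  by (auto simp: with_complements_def)

lemma with_complements_eq: "with_complements S = (\<lambda>(x, c). x + vec c) ` (S \<times> UNIV)"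
  by (auto simp: with_complements_def UNIV_bit image_iff)

definition sign_sum :: "bit ^ 'm \<Rightarrow> int" where
  "sign_sum v = (\<Sum>j\<in>UNIV. bit_sign (v $ j))"

lemma sign_sum_zero [simp]: "sign_sum (0 :: bit ^ 'm) = int CARD('m)"
  by (simp add: sign_sum_def)

lemma sign_sum_add_vec [simp]: "sign_sum (x + vec c) = bit_sign c * sign_sum x"
  by (simp add: sign_sum_def bit_sign_add sum_distrib_left mult.commute)

lemma sign_sum_add_one [simp]: "sign_sum (x + 1) = - sign_sum x"
  using sign_sum_add_vec[of x 1] by simp

lemma abs_sign_sum_less:
  fixes v :: "bit ^ 'm"
  assumes "v \<notin> {0, 1}"
  shows "\<bar>sign_sum v\<bar> < int CARD('m)"
proof -
  have less: "sign_sum w < int CARD('m)" if "w \<noteq> 0" for w :: "bit ^ 'm"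
  proof -
    from that obtain j where "w $ j \<noteq> 0" by (auto simp: vec_eq_iff)
    then have "(\<Sum>j\<in>UNIV. bit_sign (w $ j)) < (\<Sum>j\<in>(UNIV :: 'm set). 1)"
      by (intro sum_strict_mono_ex1) (auto simp: bit_sign_def)
    then show ?thesis by (simp add: sign_sum_def)
  qed
  have "v + 1 \<noteq> 0"
    using assms by (simp add: bit_vec_add_eq_iff[of v])
  with less[of v] less[of "v + 1"] assms show ?thesis by simp
qed

lemma sign_sum_triple_dvd:
  fixes x y w :: "bit ^ 'm"
  shows "8 dvd int CARD('m) + sign_sum x + sign_sum y + sign_sum w
    + sign_sum (x + y) + sign_sum (x + w) + sign_sum (y + w) + sign_sum (x + y + w)"
proof -
  have "8 dvd (\<Sum>j\<in>UNIV. (1 + bit_sign (x $ j)) * (1 + bit_sign (y $ j)) * (1 + bit_sign (w $ j)))"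
    by (rule dvd_sum) (simp add: bit_sign_def)
  then show ?thesis
    by (simp add: sign_sum_def bit_sign_add algebra_simps sum.distrib)
qed

lemma hadamard_matrix_entry: "hadamard_matrix M \<Longrightarrow> M $ i $ j = bit_sign (binary_matrix_of M $ i $ j)"
  by (auto simp: hadamard_matrix_def binary_matrix_of_def)

lemma hadamard_matrix_transpose:
  fixes M :: "int ^ 'm ^ 'm"
  assumes "hadamard_matrix M"
  shows "hadamard_matrix (transpose M)"
proof -
  let ?m = "real CARD('m)"
  define R :: "real ^ 'm ^ 'm" where "R = (\<chi> i j. real_of_int (M $ i $ j))"
  define S :: "real ^ 'm ^ 'm" where "S = (\<chi> i j. real_of_int (M $ j $ i) / ?m)"
  have "(R ** S) $ i $ j = real_of_int ((M ** transpose M) $ i $ j) / ?m" for i j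
    by (simp add: R_def S_def matrix_matrix_mult_def transpose_def sum_divide_distrib)
  then have "R ** S = mat 1"
    using assms by (simp add: hadamard_matrix_def vec_eq_iff mat_def)
  then have inverse: "S ** R = mat 1" by (simp add: matrix_left_right_inverse)
  have "real_of_int ((transpose M ** M) $ i $ j) = ?m * (S ** R) $ i $ j" for i j
    by (simp add: R_def S_def matrix_matrix_mult_def transpose_def flip: sum_divide_distrib)
  then have "real_of_int ((transpose M ** M) $ i $ j) = real_of_int (mat (int CARD('m)) $ i $ j)" for i j
    unfolding inverse by (simp add: mat_def)
  then have "transpose M ** M = mat (int CARD('m))" by (simp only: of_int_eq_iff vec_eq_iff) simp
  with assms show ?thesis by (simp add: hadamard_matrix_def transpose_def)
qed

lemma hadamard_rows_sign_sum:
  fixes M :: "int ^ 'm ^ 'm"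
  assumes "hadamard_matrix M"
  shows "sign_sum (row i (binary_matrix_of M) + row j (binary_matrix_of M))
    = (if i = j then int CARD('m) else 0)"
proof -
  have "(M ** transpose M) $ i $ j = mat (int CARD('m)) $ i $ j"
    using assms by (simp add: hadamard_matrix_def)
  then show ?thesis
    by (simp add: sign_sum_def bit_sign_add row_def matrix_matrix_mult_def transpose_def mat_def
        hadamard_matrix_entry[OF assms])
qed

context
  fixes C :: "(bit ^ 'm) set"
  assumes hadamard_code: "binary_hadamard_code C"
begin

lemma hadamard_codeE:
  obtains M :: "int ^ 'm ^ 'm"
  where "hadamard_matrix M" "C = range (\<lambda>(i, c). row i (binary_matrix_of M) + vec c)"
proof -
  obtain M :: "int ^ 'm ^ 'm" where M: "hadamard_matrix M"
    and C: "C = with_complements (rows (binary_matrix_of M))"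
    using hadamard_code unfolding binary_hadamard_code_def by blast
  have "rows (binary_matrix_of M) = range (\<lambda>i. row i (binary_matrix_of M))"
    by (auto simp: rows_def)
  then have "C = range (\<lambda>(i, c). row i (binary_matrix_of M) + vec c)"
    unfolding C with_complements_eq by (auto simp: image_iff) blast
  with M show ?thesis by (rule that)
qed

lemma hadamard_code_add_one: "x \<in> C \<Longrightarrow> x + 1 \<in> C"
  using hadamard_code with_complements_add_one unfolding binary_hadamard_code_def by blast

lemma hadamard_code_sign_sum:
  assumes "x \<in> C" "y \<in> C" "x + y \<notin> {0, 1}"
  shows "sign_sum (x + y) = 0"
proof -
  obtain M :: "int ^ 'm ^ 'm" where M: "hadamard_matrix M"
    and C: "C = range (\<lambda>(i, c). row i (binary_matrix_of M) + vec c)"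
    by (rule hadamard_codeE)
  let ?r = "\<lambda>i. row i (binary_matrix_of M)"
  obtain i c j d where "x = ?r i + vec c" "y = ?r j + vec d"
    using assms(1,2) C by auto
  then have sum: "x + y = (?r i + ?r j) + vec (c + d)"
    by (simp add: vec_add ac_simps)
  have "i \<noteq> j"
  proof
    assume "i = j"
    with sum have "x + y = vec (c + d)" by simp
    with assms(3) vec_bit_cases show False by metis
  qed
  then show ?thesis
    unfolding sum sign_sum_add_vec using hadamard_rows_sign_sum[OF M, of i j] by simp
qed

lemma hadamard_code_card: "card C = 2 * CARD('m)"
proof -
  obtain M :: "int ^ 'm ^ 'm" where M: "hadamard_matrix M"
    and C: "C = range (\<lambda>(i, c). row i (binary_matrix_of M) + vec c)"
    by (rule hadamard_codeE)
  let ?r = "\<lambda>i. row i (binary_matrix_of M)"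
  have "(i, c) = (j, d)" if eq: "?r i + vec c = ?r j + vec d" for i j c d
  proof -
    have "?r i + ?r j = ?r i + vec c + (?r j + vec c)" by (simp add: ac_simps)
    also have "\<dots> = vec d + vec c" unfolding eq by (simp add: ac_simps)
    finally have "sign_sum (?r i + ?r j) = bit_sign (c + d) * int CARD('m)"
      using sign_sum_add_vec[of 0 "c + d"] by (simp add: vec_add ac_simps)
    then have "i = j"
      using hadamard_rows_sign_sum[OF M, of i j] by (auto split: if_splits)
    with eq show ?thesis by (simp add: vec_eq_iff)
  qed
  then have "inj (\<lambda>(i, c). ?r i + vec c)" by (auto intro!: injI)
  then show ?thesis
    by (simp add: C card_image UNIV_bit card_cartesian_product flip: UNIV_Times_UNIV)
qed

lemma hadamard_code_complete:
  obtains w where "w \<in> C" "sign_sum (v + w) \<noteq> 0"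
proof -
  obtain M :: "int ^ 'm ^ 'm" where M: "hadamard_matrix M"
    and C: "C = range (\<lambda>(i, c). row i (binary_matrix_of M) + vec c)"
    by (rule hadamard_codeE)
  define u :: "int ^ 'm" where "u = (\<chi> j. bit_sign (v $ j))"
  have "M *v u \<noteq> 0"
  proof
    assume "M *v u = 0"
    then have "(transpose M ** M) *v u = 0"
      by (simp flip: matrix_vector_mul_assoc)
    moreover have "transpose M ** M = mat (int CARD('m))"
      using hadamard_matrix_transpose[OF M] by (simp add: hadamard_matrix_def)
    ultimately have "int CARD('m) * u $ j = 0" for j
      by (simp add: vec_eq_iff matrix_vector_mult_def mat_def if_distrib[of "\<lambda>x. x * _"] cong: if_cong)
    then show False by (simp add: u_def)
  qed
  then obtain i where "(M *v u) $ i \<noteq> 0" by (auto simp: vec_eq_iff)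
  then have "sign_sum (v + row i (binary_matrix_of M)) \<noteq> 0"
    by (simp add: u_def sign_sum_def bit_sign_add row_def matrix_vector_mult_def
        hadamard_matrix_entry[OF M] mult.commute)
  moreover have "row i (binary_matrix_of M) \<in> C"
    unfolding C by (rule range_eqI[of _ _ "(i, 0)"]) simp
  ultimately show ?thesis by (rule that[rotated])
qed

lemma hadamard_code_triple_dvd:
  assumes "0 \<in> C" "x \<in> C" "y \<in> C" "w \<in> C"
    and "{x, y, w, x + y, x + w, y + w} \<inter> {0, 1} = {}"
  shows "8 dvd int CARD('m) + sign_sum (x + y + w)"
proof -
  have "sign_sum v = 0" if "v \<in> {x, y, w, x + y, x + w, y + w}" for v
    using that assms hadamard_code_sign_sum[of v 0] hadamard_code_sign_sum by auto
  then show ?thesis using sign_sum_triple_dvd[of x y w] by simp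
qed

text \<open>
  If \<open>x + y\<close> were not a codeword, the congruence would make it orthogonal to the whole code.
\<close>

lemma hadamard_code_small_add_closed:
  assumes zero: "0 \<in> C" and card: "CARD('m) = 4 * n" "n \<le> 2"
    and x: "x \<in> C" and y: "y \<in> C"
  shows "x + y \<in> C"
proof (rule ccontr)
  assume notin: "x + y \<notin> C"
  obtain w where w: "w \<in> C" "sign_sum (x + y + w) \<noteq> 0"
    by (rule hadamard_code_complete)
  have one: "1 \<in> C" using hadamard_code_add_one[OF zero] by simp
  have xy: "x \<notin> {0, 1}" "y \<notin> {0, 1}" "x + y \<notin> {0, 1}"
    using notin x y zero one hadamard_code_add_one[OF x] hadamard_code_add_one[OF y]
    by (auto simp: add.commute[of 1])
  have "x + y + w \<notin> {0, 1}"
    unfolding bit_vec_add_zero_one_iff using notin w(1) hadamard_code_add_one[OF w(1)] by auto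
  then have less: "\<bar>sign_sum (x + y + w)\<bar> < 4 * int n"
    using abs_sign_sum_less card(1) by fastforce
  have not_w: "v + w \<notin> {0, 1}" if "sign_sum (x + y + v) = 0" for v
    unfolding bit_vec_add_zero_one_iff using that w(2) by (auto simp flip: add.assoc)
  have "sign_sum (x + y + 0) = 0" "sign_sum (x + y + x) = 0" "sign_sum (x + y + y) = 0"
    using hadamard_code_sign_sum[OF x zero] hadamard_code_sign_sum[OF y zero]
      hadamard_code_sign_sum[OF x y] xy
    by (simp, simp add: add.commute, simp)
  from this[THEN not_w] have "8 dvd 4 * int n + sign_sum (x + y + w)"
    using hadamard_code_triple_dvd[OF zero x y w(1)] xy card(1) by simp
  with less card(2) have "sign_sum (x + y + w) = 0" by presburger
  with w(2) show False ..
qed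

end

section \<open>Kernels and propelinear codes\<close>

lemma code_kernel_add_one_closed:
  assumes "\<And>x. x \<in> S \<Longrightarrow> x + 1 \<in> S" shows "1 \<in> code_kernel S"
proof -
  have "x \<in> (\<lambda>x. x + 1) ` S" if "x \<in> S" for x
    using assms[OF that] by (intro image_eqI[of _ _ "x + 1"]) auto
  then show ?thesis using assms by (auto simp: code_kernel_def)
qed

lemma code_kernel_iff:
  assumes "0 \<in> C"
  shows "z \<in> code_kernel C \<longleftrightarrow> z \<in> C \<and> (\<forall>x\<in>C. x + z \<in> C)"
proof
  assume "z \<in> code_kernel C"
  then have kernel: "(\<lambda>x. x + z) ` C = C" by (simp add: code_kernel_def)
  with assms have "0 + z \<in> C" by blast
  with kernel show "z \<in> C \<and> (\<forall>x\<in>C. x + z \<in> C)" by auto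
next
  assume closed: "z \<in> C \<and> (\<forall>x\<in>C. x + z \<in> C)"
  have "x \<in> (\<lambda>x. x + z) ` C" if "x \<in> C" for x
    using closed that by (intro image_eqI[of _ _ "x + z"]) auto
  with closed show "z \<in> code_kernel C" by (auto simp: code_kernel_def)
qed

lemma code_kernel_eq_self:
  assumes "0 \<in> C" "\<And>x y. x \<in> C \<Longrightarrow> y \<in> C \<Longrightarrow> x + y \<in> C"
  shows "code_kernel C = C"
  using assms by (auto simp: code_kernel_iff)

lemma perm_action_simps [simp]:
  "perm_action id v = v" "perm_action p 0 = 0" "perm_action p 1 = 1" "perm_action p (vec c) = vec c"
  "perm_action p (x + y) = perm_action p x + perm_action p y"
  by (simp_all add: perm_action_def vec_eq_iff)

lemma perm_action_comp:
  "bij p \<Longrightarrow> bij q \<Longrightarrow> perm_action p (perm_action q v) = perm_action (p \<circ> q) v"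
  by (simp add: perm_action_def vec_eq_iff o_inv_distrib)

lemma perm_action_eq_zero_iff: "bij p \<Longrightarrow> perm_action p x = 0 \<longleftrightarrow> x = 0"
  by (auto simp: perm_action_def vec_eq_iff) (metis bij_inv_eq_iff)

lemma group_propelinear:
  assumes "propelinear_code C \<pi>" "\<pi> 0 = id" "finite C"
  shows "group (propelinear_group C \<pi>)"
proof -
  have zero: "0 \<in> C" and bij: "\<And>x. x \<in> C \<Longrightarrow> bij (\<pi> x)"
    and closed: "\<And>x y. x \<in> C \<Longrightarrow> y \<in> C \<Longrightarrow> x + perm_action (\<pi> x) y \<in> C"
    and comp: "\<And>x y. x \<in> C \<Longrightarrow> y \<in> C \<Longrightarrow> \<pi> (x + perm_action (\<pi> x) y) = \<pi> x \<circ> \<pi> y"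
    using assms(1) unfolding propelinear_code_def by auto
  let ?m = "\<lambda>x y. x + perm_action (\<pi> x) y"
  have assoc: "?m (?m x y) z = ?m x (?m y z)" if "x \<in> C" "y \<in> C" "z \<in> C" for x y z
    using that by (simp add: comp perm_action_comp[OF bij bij] add.assoc)
  have left_inverse: "\<exists>y\<in>C. ?m y x = 0" if x: "x \<in> C" for x
  proof -
    have "inj_on (?m x) C"
    proof (rule inj_onI)
      fix y z assume "?m x y = ?m x z"
      then have "perm_action (\<pi> x) (y + z) = 0" by simp
      then have "y + z = 0" using perm_action_eq_zero_iff[OF bij[OF x]] by blast
      then show "y = z" by (simp add: bit_vec_add_eq_iff)
    qed
    then have "?m x ` C = C"
      using closed[OF x] assms(3) by (intro endo_inj_surj) auto
    then obtain y where y: "y \<in> C" "?m x y = 0"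
      using zero by (metis (no_types, lifting) imageE)
    have "perm_action (\<pi> x) (?m y x) = perm_action (\<pi> x) y + x"
      using comp[OF x y(1)] assms(2) by (simp add: perm_action_comp bij x y)
    also have "\<dots> = 0" using y(2) by (simp add: add.commute)
    finally have "?m y x = 0" using perm_action_eq_zero_iff[OF bij[OF x]] by blast
    with y(1) show ?thesis by blast
  qed
  show ?thesis
    by (rule groupI)
      (use zero closed assoc left_inverse in \<open>simp_all add: propelinear_group_def assms(2)\<close>)
qed

locale hfp =
  fixes C :: "(bit ^ 'm) set" and \<pi> :: "bit ^ 'm \<Rightarrow> 'm \<Rightarrow> 'm" and base :: 'm
  assumes hfp_code: "hfp_code C \<pi>"
begin

abbreviation "G \<equiv> propelinear_group C \<pi>"

lemma
  hadamard: "binary_hadamard_code C" and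
  propelinear: "propelinear_code C \<pi>" and
  pi_zero: "\<pi> 0 = id" and pi_one: "\<pi> 1 = id" and
  pi_free: "\<And>x i. x \<in> C \<Longrightarrow> \<pi> x i = i \<Longrightarrow> x \<in> {0, 1}"
  using hfp_code unfolding hfp_code_def by blast+

lemma
  zero_mem: "0 \<in> C" and
  bij_pi: "\<And>x. x \<in> C \<Longrightarrow> bij (\<pi> x)" and
  pi_comp: "\<And>x y. x \<in> C \<Longrightarrow> y \<in> C \<Longrightarrow> \<pi> (x \<otimes>\<^bsub>G\<^esub> y) = \<pi> x \<circ> \<pi> y"
  using propelinear unfolding propelinear_code_def propelinear_group_def by auto

lemma add_one_mem: "x \<in> C \<Longrightarrow> x + 1 \<in> C"
  using hadamard by (rule hadamard_code_add_one)

lemma add_vec_mem: "x \<in> C \<Longrightarrow> x + vec c \<in> C"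
  by (cases c) (simp_all add: add_one_mem)

lemma one_mem: "1 \<in> C"
  using add_one_mem[OF zero_mem] by simp

lemma finite_C: "finite C"
  using hadamard_code_card[OF hadamard] by (intro card_ge_0_finite) simp

lemma carrier_G [simp]: "carrier G = C"
  and one_G [simp]: "\<one>\<^bsub>G\<^esub> = 0"
  and mult_G: "x \<otimes>\<^bsub>G\<^esub> y = x + perm_action (\<pi> x) y"
  by (simp_all add: propelinear_group_def)

sublocale group G
  using propelinear pi_zero finite_C by (rule group_propelinear)

lemma mult_mem: "x \<in> C \<Longrightarrow> y \<in> C \<Longrightarrow> x \<otimes>\<^bsub>G\<^esub> y \<in> C"
  using m_closed by simp

lemma mult_zero [simp]: "x \<in> C \<Longrightarrow> x \<otimes>\<^bsub>G\<^esub> 0 = x"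
  and zero_mult [simp]: "x \<in> C \<Longrightarrow> 0 \<otimes>\<^bsub>G\<^esub> x = x"
  using r_one[of x] l_one[of x] by simp_all

lemma mult_one: "x \<otimes>\<^bsub>G\<^esub> 1 = x + 1" and one_mult: "1 \<otimes>\<^bsub>G\<^esub> x = x + 1"
  by (simp_all add: mult_G pi_one add.commute)

lemma one_code_kernel: "1 \<in> code_kernel C"
  using add_one_mem by (rule code_kernel_add_one_closed)

lemma perm_action_code_kernel:
  assumes x: "x \<in> C" and z: "z \<in> code_kernel C"
  shows "perm_action (\<pi> x) z \<in> code_kernel C"
proof -
  have z_add: "z \<in> C" "y + z \<in> C" if "y \<in> C" for y
    using z that by (simp_all add: code_kernel_iff[OF zero_mem])
  have closed: "y + perm_action (\<pi> x) z \<in> C" if y: "y \<in> C" for y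
  proof -
    define w where "w = inv\<^bsub>G\<^esub> x \<otimes>\<^bsub>G\<^esub> y"
    have w: "w \<in> C" "y = x \<otimes>\<^bsub>G\<^esub> w"
      using x y inv_closed[of x] by (simp_all add: w_def mult_mem flip: m_assoc)
    then have "y + perm_action (\<pi> x) z = x \<otimes>\<^bsub>G\<^esub> (w + z)"
      by (simp add: mult_G add.assoc)
    then show ?thesis using mult_mem[OF x z_add(2)[OF w(1)]] by simp
  qed
  then show ?thesis
    using closed[OF zero_mem] by (simp add: code_kernel_iff[OF zero_mem])
qed

definition pos :: "bit ^ 'm \<Rightarrow> 'm" where
  "pos x = inv_into UNIV (\<pi> x) base"

lemma mult_base: "(x \<otimes>\<^bsub>G\<^esub> y) $ base = x $ base + y $ pos x"
  by (simp add: mult_G perm_action_def pos_def)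

lemma pos_eq_iff:
  assumes x: "x \<in> C" and y: "y \<in> C"
  shows "pos y = pos x \<longleftrightarrow> y = x \<or> y = x + 1"
proof
  assume eq: "pos y = pos x"
  have pi_pos: "\<pi> x (pos x) = base" if "x \<in> C" for x
    using bij_pi[OF that] by (simp add: pos_def bij_is_surj surj_f_inv_f)
  define z where "z = inv\<^bsub>G\<^esub> x \<otimes>\<^bsub>G\<^esub> y"
  have z: "z \<in> C" "y = x \<otimes>\<^bsub>G\<^esub> z"
    using x y inv_closed[of x] by (simp_all add: z_def mult_mem flip: m_assoc)
  have "\<pi> x (\<pi> z (pos x)) = \<pi> x (pos x)"
    using pi_comp[OF x z(1)] z(2) pi_pos[OF x] pi_pos[OF y] eq by (metis comp_apply)
  then have "\<pi> z (pos x) = pos x"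
    using bij_pi[OF x] by (meson bij_is_inj injD)
  then have "z \<in> {0, 1}" using pi_free z(1) by blast
  then show "y = x \<or> y = x + 1" using z(2) x by (auto simp: mult_one)
next
  assume "y = x \<or> y = x + 1"
  then show "pos y = pos x"
    using pi_comp[OF x one_mem] by (auto simp: pos_def mult_one pi_one)
qed

lemma pos_add_vec: "x \<in> C \<Longrightarrow> pos (x + vec c) = pos x"
  using pos_eq_iff[of x "x + vec c"] add_vec_mem[of x c] by (cases c) simp_all

lemma card_pos_fibre: "x \<in> C \<Longrightarrow> card {y \<in> C. pos y = pos x} = 2"
proof -
  assume "x \<in> C"
  then have "{y \<in> C. pos y = pos x} = {x, x + 1}"
    using add_one_mem by (auto simp: pos_eq_iff)
  moreover have "x \<noteq> x + 1" by simp
  ultimately show ?thesis by (simp add: card_2_iff)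
qed

lemma sum_pos_range: "(\<Sum>x\<in>C. F (pos x)) = 2 * (\<Sum>j\<in>pos ` C. F j :: int)"
proof -
  have "(\<Sum>x\<in>C. F (pos x)) = (\<Sum>j\<in>pos ` C. \<Sum>y | y \<in> C \<and> pos y = j. F (pos y))"
    using finite_C by (rule sum.image_gen)
  also have "\<dots> = (\<Sum>j\<in>pos ` C. 2 * F j)"
    by (rule sum.cong) (auto simp: card_pos_fibre)
  finally show ?thesis by (simp add: sum_distrib_left)
qed

lemma pos_surj: "pos ` C = UNIV"
proof (rule card_subset_eq)
  have "int (card C) = 2 * int (card (pos ` C))"
    using sum_pos_range[of "\<lambda>_. 1"] by simp
  then show "card (pos ` C) = CARD('m)"
    using hadamard_code_card[OF hadamard] by simp
qed simp_all

lemma sum_pos: "(\<Sum>x\<in>C. F (pos x)) = 2 * (\<Sum>j\<in>UNIV. F j :: int)"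
  using sum_pos_range pos_surj by simp

lemma sum_right_translate:
  assumes "g \<in> C - {0, 1}"
  shows "(\<Sum>x\<in>C. bit_sign (x $ base + (x \<otimes>\<^bsub>G\<^esub> g) $ base)) = 0"
proof -
  have "(\<Sum>x\<in>C. bit_sign (x $ base + (x \<otimes>\<^bsub>G\<^esub> g) $ base)) = 2 * sign_sum g"
    using sum_pos[of "\<lambda>j. bit_sign (g $ j)"] by (simp add: mult_base sign_sum_def)
  also have "sign_sum g = 0"
    using hadamard_code_sign_sum[OF hadamard _ zero_mem, of g] assms by simp
  finally show ?thesis by simp
qed

end

section \<open>Codes of type Q\<close>

lemma gword_eval_replicate:
  assumes "group G" "f g \<in> carrier G"
  shows "gword_eval G f (replicate k (g, True)) = f g [^]\<^bsub>G\<^esub> k"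
proof -
  interpret group G by fact
  show ?thesis
  proof (induction k)
    case (Suc k)
    then show ?case
      using nat_pow_Suc2[OF assms(2), of k] by (simp add: gword_eval_def)
  qed (simp add: gword_eval_def)
qed

lemma has_presentation_relation:
  "has_presentation G f R \<Longrightarrow> (l, r) \<in> R \<Longrightarrow> gword_eval G f l = gword_eval G f r"
  using pc_relation[of l r R "[]" "[]"] by (simp add: has_presentation_def)

locale hfp_type_Q = hfp C \<pi> base
  for C :: "(bit ^ 'm) set" and \<pi> base +
  fixes n :: nat and a b :: "bit ^ 'm"
  assumes type_Q: "hfp_code_type_Q n C \<pi> a b"
begin

lemma card_index: "CARD('m) = 4 * n"
  and presentation: "has_presentation G (case_gen a b) (type_Q_relations n)"
  using type_Q by (simp_all add: hfp_code_type_Q_def)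

lemma gen_mem: "a \<in> C" "b \<in> C"
proof -
  have "case_gen a b g \<in> C" for g
    using presentation unfolding has_presentation_def by (simp add: image_subset_iff)
  from this[of Gen_a] this[of Gen_b] show "a \<in> C" "b \<in> C" by simp_all
qed

lemma generate_G: "generate G {a, b} = C"
proof -
  have "range (case_gen a b) = {a, b}"
    by (auto simp: image_iff split: gen.splits intro: exI[of _ Gen_a] exI[of _ Gen_b])
  then show ?thesis
    using presentation unfolding has_presentation_def by simp
qed

sublocale dicyclic_group G n a b
proof
  note relation = has_presentation_relation[OF presentation]
  show "n > 0" using card_index zero_less_card_finite[where 'a = 'm] by linarith
  show "a \<in> carrier G" "b \<in> carrier G" "generate G {a, b} = carrier G"
    using gen_mem generate_G by simp_all
  show "a [^]\<^bsub>G\<^esub> (2 * n) = b \<otimes>\<^bsub>G\<^esub> b"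
    using relation[of "replicate (2 * n) (Gen_a, True)" "[(Gen_b, True), (Gen_b, True)]"] gen_mem
      gword_eval_replicate[OF is_group, of "case_gen a b" Gen_a "2 * n"]
    by (simp add: type_Q_relations_def gword_eval_def)
  show "inv\<^bsub>G\<^esub> b \<otimes>\<^bsub>G\<^esub> (a \<otimes>\<^bsub>G\<^esub> b) = inv\<^bsub>G\<^esub> a"
    using relation[of "[(Gen_b, False), (Gen_a, True), (Gen_b, True)]" "[(Gen_a, False)]"] gen_mem inv_closed[of a]
    by (simp add: type_Q_relations_def gword_eval_def)
  show "order G = 8 * n"
    using hadamard_code_card[OF hadamard] card_index by (simp add: order_def)
qed

lemma apow_half: "apow (2 * int n) = 1"
  using involution_cases[of 1] one_mem by (simp add: mult_one)

sublocale hadamard_dicyclic_group G n a b "\<lambda>x. x $ base"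
  by unfold_locales (simp_all add: apow_half one_mult sum_right_translate)

end

context hfp_type_Q
begin

lemma code_kernel_dim_2E:
  assumes "vec.dim (code_kernel C) = 2"
  obtains z where "z \<notin> {0, 1}" "z $ base = 0" "code_kernel C = {0, 1, z, z + 1}"
proof -
  obtain z where z: "z \<notin> {0, 1}" "code_kernel C = {0, 1, z, z + 1}"
    using bit_subspace_dim_2[OF subspace_code_kernel assms one_code_kernel] by auto
  show ?thesis
  proof (cases "z $ base = 0")
    case False
    with z show ?thesis
      by (intro that[of "z + 1"]) (auto simp: bit_vec_add_eq_iff[of z])
  qed (use z that in blast)
qed

lemma n_gt_2_if_dim_2:
  assumes "vec.dim (code_kernel C) = 2"
  shows "n > 2"
proof (rule ccontr)
  assume "\<not> n > 2"
  then have "code_kernel C = C"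
    using hadamard_code_small_add_closed[OF hadamard zero_mem card_index]
    by (intro code_kernel_eq_self zero_mem) simp_all
  moreover obtain z where "code_kernel C = {0, 1, z, z + 1}"
    using assms by (rule code_kernel_dim_2E)
  ultimately have "card C \<le> 4"
    using card_length[of "[0, 1, z, z + 1]"] by simp
  then show False
    using order_G n_pos by (simp add: order_def)
qed

lemma dicyclic_kernel_character_if_dim_2:
  assumes dim: "vec.dim (code_kernel C) = 2"
  obtains \<psi> h where "dicyclic_kernel_character G n a b (\<lambda>x. x $ base) \<psi> h"
proof -
  obtain z where z: "z \<notin> {0, 1}" "z $ base = 0" and kernel: "code_kernel C = {0, 1, z, z + 1}"
    using dim by (rule code_kernel_dim_2E)
  have z_mem: "z \<in> C"
    using kernel code_kernel_iff[OF zero_mem] by blast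
  define \<psi> where "\<psi> x = x $ base + (x \<otimes>\<^bsub>G\<^esub> z) $ base" for x
  have perm_z: "perm_action (\<pi> x) z = z + vec (\<psi> x)" if x: "x \<in> C" for x
  proof -
    have "perm_action (\<pi> x) z \<in> {0, 1, z, z + 1}"
      using perm_action_code_kernel[OF x, of z] kernel by simp
    moreover have "perm_action (\<pi> x) (z + vec c) \<noteq> 0" for c
      unfolding perm_action_eq_zero_iff[OF bij_pi[OF x]] bit_vec_add_eq_iff[of z]
      using z(1) vec_bit_cases[of c] by auto
    from this[of 0] this[of 1] have "perm_action (\<pi> x) z \<notin> {0, 1}" by auto
    ultimately obtain c where c: "perm_action (\<pi> x) z = z + vec c"
      using that[of 0] that[of 1] by auto
    then have "\<psi> x = c" using z(2) by (simp add: \<psi>_def mult_G)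
    with c show ?thesis by simp
  qed
  have "\<psi> (x \<otimes>\<^bsub>G\<^esub> y) = \<psi> x + \<psi> y" if "x \<in> C" "y \<in> C" for x y
  proof -
    have "x \<otimes>\<^bsub>G\<^esub> y \<otimes>\<^bsub>G\<^esub> z = x \<otimes>\<^bsub>G\<^esub> (y \<otimes>\<^bsub>G\<^esub> z)"
      using that z_mem m_assoc by simp
    also have "\<dots> = x \<otimes>\<^bsub>G\<^esub> y + (z + vec (\<psi> x + \<psi> y))"
      using that by (simp add: mult_G perm_z vec_add ac_simps)
    finally show ?thesis by (simp add: \<psi>_def[of "x \<otimes>\<^bsub>G\<^esub> y"] z(2) flip: add.assoc)
  qed
  then have "dicyclic_kernel_character G n a b (\<lambda>x. x $ base) \<psi> z"
    using z_mem z(1) n_gt_2_if_dim_2[OF dim]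
    by unfold_locales (simp_all add: apow_half \<psi>_def flip: add.assoc)
  then show ?thesis by (rule that)
qed

lemma twisted_generator_if_dim_2:
  assumes dim: "vec.dim (code_kernel C) = 2"
  obtains h where "twisted_dicyclic_group G n a h (\<lambda>x. x $ base)"
proof -
  obtain \<psi> h where "dicyclic_kernel_character G n a b (\<lambda>x. x $ base) \<psi> h"
    using dim by (rule dicyclic_kernel_character_if_dim_2)
  then interpret dicyclic_kernel_character G n a b "\<lambda>x. x $ base" \<psi> h .
  obtain p where h: "h = apow p \<otimes>\<^bsub>G\<^esub> b" and "even n"
    "\<And>k. (apow k \<otimes>\<^bsub>G\<^esub> h) $ base = apow k $ base + of_int k"
    by (rule h_normal_form) blast
  then have "twisted_dicyclic_group G n a h (\<lambda>x. x $ base)"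
    using hadamard_dicyclic_group_apow_b[of p] n_gt_2_if_dim_2[OF dim]
    by (simp add: twisted_dicyclic_group_def twisted_dicyclic_group_axioms_def)
  then show ?thesis by (rule that)
qed

end

section \<open>The transpose code\<close>

context hfp
begin

context
  fixes H :: "bit ^ 'm ^ 'm"
  assumes rows_H: "bij_betw (\<lambda>i. row i H) UNIV {x \<in> C. x $ base = 0}"
begin

lemma row_mem: "row i H \<in> C" and row_base: "row i H $ base = 0"
  using bij_betwE[OF rows_H] by auto

lemma column_eq: "g \<in> C \<Longrightarrow> column (pos g) H + vec (g $ base) = (\<chi> i. (g \<otimes>\<^bsub>G\<^esub> row i H) $ base)"
  by (simp add: vec_eq_iff column_def row_def mult_base add.commute)

lemma column_code_eq: "column_code H = (\<lambda>g. \<chi> i. (g \<otimes>\<^bsub>G\<^esub> row i H) $ base) ` C"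
proof (intro equalityI subsetI)
  fix w assume "w \<in> column_code H"
  then obtain j c where w: "w = column j H + vec c"
    by (auto simp: column_code_def columns_def with_complements_eq)
  obtain g where g: "g \<in> C" "j = pos g" using pos_surj by blast
  define g' where "g' = g + vec (g $ base + c)"
  have "g' \<in> C" "g' $ base = c" "pos g' = j"
    using g add_vec_mem pos_add_vec by (simp_all add: g'_def)
  then have "w = (\<chi> i. (g' \<otimes>\<^bsub>G\<^esub> row i H) $ base)"
    using column_eq[of g'] w by simp
  with \<open>g' \<in> C\<close> show "w \<in> (\<lambda>g. \<chi> i. (g \<otimes>\<^bsub>G\<^esub> row i H) $ base) ` C" by blast
next
  fix w assume "w \<in> (\<lambda>g. \<chi> i. (g \<otimes>\<^bsub>G\<^esub> row i H) $ base) ` C"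
  then obtain g where "g \<in> C" "w = (\<chi> i. (g \<otimes>\<^bsub>G\<^esub> row i H) $ base)" by blast
  then have "w = column (pos g) H + vec (g $ base)" by (simp add: column_eq)
  then show "w \<in> column_code H"
    by (auto simp: column_code_def columns_def with_complements_eq image_iff)
qed

definition row_index :: "bit ^ 'm \<Rightarrow> 'm" where
  "row_index x = the_inv (\<lambda>i. row i H) (x + vec (x $ base))"

lemma inj_row: "inj (\<lambda>i. row i H)"
  using rows_H by (rule bij_betw_imp_inj_on)

lemma row_row_index:
  assumes "x \<in> C" shows "row (row_index x) H = x + vec (x $ base)"
proof -
  have "x + vec (x $ base) \<in> {x \<in> C. x $ base = 0}"
    using assms add_vec_mem by simp
  then have "x + vec (x $ base) \<in> range (\<lambda>i. row i H)"
    using rows_H by (simp add: bij_betw_def)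
  then show ?thesis
    unfolding row_index_def by (rule f_the_inv_into_f[OF inj_row])
qed

lemma row_index_row: "row_index (row i H) = i"
  using the_inv_f_f[OF inj_row] by (simp add: row_index_def row_base)

lemma left_kernel_of_column_kernel:
  assumes "z \<in> code_kernel (column_code H)"
  shows "(\<lambda>x. z $ row_index x) \<in> left_kernel G (\<lambda>x. x $ base)"
proof (rule left_kernelI)
  fix g assume "g \<in> carrier G"
  then have "g \<in> C" by simp
  then have "(\<chi> i. (g \<otimes>\<^bsub>G\<^esub> row i H) $ base) + z \<in> column_code H"
    using assms unfolding code_kernel_def column_code_eq by blast
  then obtain h where h: "h \<in> C"
    "(\<chi> i. (g \<otimes>\<^bsub>G\<^esub> row i H) $ base) + z = (\<chi> i. (h \<otimes>\<^bsub>G\<^esub> row i H) $ base)"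
    unfolding column_code_eq by blast
  have "(g \<otimes>\<^bsub>G\<^esub> x) $ base + z $ row_index x = (h \<otimes>\<^bsub>G\<^esub> x) $ base" if x: "x \<in> C" for x
  proof -
    have "(g \<otimes>\<^bsub>G\<^esub> row i H) $ base + z $ i = (h \<otimes>\<^bsub>G\<^esub> row i H) $ base" for i
      using h(2) by (simp add: vec_eq_iff)
    from this[of "row_index x"] show ?thesis
      by (simp add: row_row_index[OF x] mult_base ac_simps)
  qed
  with h(1) show "\<exists>h\<in>carrier G. \<forall>x\<in>carrier G.
      (g \<otimes>\<^bsub>G\<^esub> x) $ base + z $ row_index x = (h \<otimes>\<^bsub>G\<^esub> x) $ base"
    by auto
qed

lemma column_kernel_trivial:
  assumes trivial: "\<And>t. t \<in> left_kernel G (\<lambda>x. x $ base) \<Longrightarrow> \<exists>c. \<forall>x\<in>C. t x = c"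
  shows "code_kernel (column_code H) = {0, 1}"
proof (intro equalityI subsetI)
  fix z assume "z \<in> code_kernel (column_code H)"
  from trivial[OF left_kernel_of_column_kernel[OF this]]
  obtain c where c: "\<forall>x\<in>C. z $ row_index x = c" by blast
  have "z $ i = c" for i
    using bspec[OF c row_mem, of i] by (simp add: row_index_row)
  then have "z = vec c" by (simp add: vec_eq_iff)
  then show "z \<in> {0, 1}" using vec_bit_cases by simp
next
  fix z :: "bit ^ 'm" assume "z \<in> {0, 1}"
  moreover have "0 \<in> code_kernel (column_code H)" by (simp add: code_kernel_def)
  moreover have "1 \<in> code_kernel (column_code H)"
    by (rule code_kernel_add_one_closed) (simp add: column_code_def with_complements_add_one)
  ultimately show "z \<in> code_kernel (column_code H)" by blast
qed

end

end

theorem theorem2: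
  fixes n :: nat
    and C :: "(bit ^ 'm::{finite,linorder}) set"
    and \<pi> :: "bit ^ ('m::{finite,linorder}) \<Rightarrow> 'm \<Rightarrow> 'm"
    and a b :: "bit ^ ('m::{finite,linorder})"
    and H :: "bit ^ ('m::{finite,linorder}) ^ ('m::{finite,linorder})"
  assumes "hfp_code_type_Q n C \<pi> a b"
    and "vec.dim (code_kernel C) = 2"
    and "row_matrix_of_code C H"
  shows "vec.dim (code_kernel (column_code H)) = 1"
proof -
  interpret hfp_type_Q C \<pi> "Min UNIV" n a b
    using assms(1) by unfold_locales (auto simp: hfp_code_type_Q_def)
  obtain h where "twisted_dicyclic_group G n a h (\<lambda>x. x $ Min UNIV)"
    using assms(2) by (rule twisted_generator_if_dim_2)
  then interpret h: twisted_dicyclic_group G n a h "\<lambda>x. x $ Min UNIV" .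
  have "\<exists>c. \<forall>x\<in>C. t x = c" if "t \<in> left_kernel G (\<lambda>x. x $ Min UNIV)" for t
    using h.left_kernel_trivial[OF that] by simp
  then have "code_kernel (column_code H) = {0, 1}"
    using assms(3) unfolding row_matrix_of_code_def by (intro column_kernel_trivial)
  then show ?thesis by (simp add: dim_zero_one_bit)
qed

end
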